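(* Let $n\ge 2$. Let $\varphi,\psi,\xi$ be $C^1$ functions near $1$ satisfying $\varphi(1)=\xi(1)=1$, $\psi(1)=0$, $$\varphi'\ge 0,\quad\psi'\ge 0,\quad\varphi'+\psi'>0\qquad\text{near } 1,$$ $$\varphi'\xi+\varphi\xi'\ge 0\qquad\text{near } 1,$$ and let $$\Phi(v,x,\lambda;y):=\varphi(\lambda)\,v(x+\xi(\lambda)y)+\psi(\lambda).$$ Let $\Omega\subset\mathbb R^n$ be a bounded open set containing the origin $0$. Assume that $u\in C^0(\overline\Omega\setminus\{0\})$, that $v$ is $C^0$ in some open neighborhood of $\overline\Omega$ and $C^1$ near the origin, and that $$v>0\ \text{ in }\overline\Omega,\qquad u>v\ \text{ on }\overline\Omega\setminus\{0\},\qquad \Delta u\le 0\ \text{ in }\Omega\setminus\{0\}.$$ Assume also that there exists some $\epsilon_4>0$ such that for any $|x|<\epsilon_4$ and $|\lambda-1|<\epsilon_4$, $$\inf_{\Omega\setminus\{0\}}\left[u-\Phi(v,x,\lambda;\cdot)\right]=0\quad\text{implies}\quad\liminf_{|y|\to 0}\left[u(y)-\Phi(v,x,\lambda;y)\right]=0 .$$ Then $$\liminf_{|x|\to 0}[u(x)-v(x)]>0 .$$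
   Context: Since $u$ is only assumed continuous, $\Delta u\le 0$ is understood in the distribution sense. *)

theory Defs
  imports "HOL-Analysis.Analysis"
begin

definition partial_deriv :: "'a::euclidean_space \<Rightarrow> ('a \<Rightarrow> real) \<Rightarrow> 'a \<Rightarrow> real"
  where "partial_deriv i f x = frechet_derivative f (at x) i"

text \<open>Meant for open \<open>S\<close>: the values of \<open>f\<close> outside \<open>S\<close> are then irrelevant.\<close>

primrec Ck_on :: "nat \<Rightarrow> 'a::euclidean_space set \<Rightarrow> ('a \<Rightarrow> real) \<Rightarrow> bool"
  where
    "Ck_on 0 S f \<longleftrightarrow> continuous_on S f"
  | "Ck_on (Suc k) S f \<longleftrightarrow>
       (\<forall>x\<in>S. f differentiable (at x)) \<and> (\<forall>i\<in>Basis. Ck_on k S (partial_deriv i f))"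

definition laplacian :: "('a::euclidean_space \<Rightarrow> real) \<Rightarrow> 'a \<Rightarrow> real"
  where "laplacian f x = (\<Sum>i\<in>Basis. partial_deriv i (partial_deriv i f) x)"

definition test_function :: "'a::euclidean_space set \<Rightarrow> ('a \<Rightarrow> real) \<Rightarrow> bool"
  where "test_function U \<eta> \<longleftrightarrow>
    (\<forall>k. Ck_on k UNIV \<eta>) \<and>
    compact (closure {x. \<eta> x \<noteq> 0}) \<and> closure {x. \<eta> x \<noteq> 0} \<subseteq> U"

text \<open>
  \<open>\<Delta>u \<le> 0\<close> in \<open>U\<close> in the sense of distributions, for \<open>U\<close> open and \<open>u\<close> continuous on \<open>U\<close>.
  The integrand is then continuous with compact support in \<open>U\<close>, hence integrable.
\<close>

definition laplacian_nonpos_distr :: "'a::euclidean_space set \<Rightarrow> ('a \<Rightarrow> real) \<Rightarrow> bool"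
  where "laplacian_nonpos_distr U u \<longleftrightarrow>
    (\<forall>\<eta>. test_function U \<eta> \<and> (\<forall>x. 0 \<le> \<eta> x) \<longrightarrow>
      (LINT x:U|lborel. u x * laplacian \<eta> x) \<le> 0)"

text \<open>
  The argument \<open>l\<close> is the scaling parameter \<open>\<lambda>\<close>.
  \<open>v\<close> is a total function here, but only its values near \<open>closure \<Omega>\<close> carry information.
  For \<open>y \<in> \<Omega>\<close> (bounded), the point \<open>x + \<xi> l *\<^sub>R y\<close> lies in a given neighbourhood of
  \<open>closure \<Omega>\<close> as soon as \<open>x\<close> is close to \<open>0\<close> and \<open>l\<close> is close to \<open>1\<close>.
\<close>

definition Phi ::
  "(real \<Rightarrow> real) \<Rightarrow> (real \<Rightarrow> real) \<Rightarrow> (real \<Rightarrow> real) \<Rightarrow>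
   ('a::euclidean_space \<Rightarrow> real) \<Rightarrow> 'a \<Rightarrow> real \<Rightarrow> 'a \<Rightarrow> real"
  where "Phi \<phi> \<psi> \<xi> v x l y = \<phi> l * v (x + \<xi> l *\<^sub>R y) + \<psi> l"

end

theory Submission
  imports Defs
begin

text \<open>
  Suppose the conclusion fails. Since \<open>u > v\<close> off the origin, \<open>u\<close> then has the lower limit \<open>v 0\<close> there.
  For \<open>x\<close> near \<open>0\<close> the function \<open>Phi \<phi> \<psi> \<xi> v x l\<close> lies below \<open>u\<close> when \<open>l\<close> is slightly smaller
  than \<open>1\<close> and not below \<open>u\<close> when \<open>l\<close> is slightly larger, so there is a critical value
  \<open>l = \<Lambda> x\<close> at which the infimum of the difference is \<open>0\<close> (\<open>ex_critical_parameter\<close>). The last hypothesis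
  places the contact at the origin:
  \<open>\<phi> (\<Lambda> x) * v x + \<psi> (\<Lambda> x) = v 0\<close>. Thus a whole family of differentiable functions touches \<open>u\<close> from
  below at the origin.

  A function that is superharmonic off an isolated point cannot have a convex kink there:
  two differentiable minorants that attain the lower limit of \<open>u\<close> at the origin have the same gradient
  (\<open>distr_superharmonic_touching_gradients_eq\<close>). For the family above this means
  \<open>\<phi> (\<Lambda> x) * \<xi> (\<Lambda> x)\<close> times the gradient of \<open>v\<close> at \<open>x\<close> is a vector \<open>p\<close> that does not depend on \<open>x\<close>.
  So all gradients of \<open>v\<close> near \<open>0\<close> are positive multiples of \<open>p\<close>. As \<open>v x\<close> increases, \<open>\<Lambda> x\<close>
  decreases, and with it \<open>\<phi> * \<xi>\<close>; hence the gradient of \<open>v\<close> grows in the direction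
  in which \<open>v\<close> grows, and \<open>v\<close> lies above its tangent plane at \<open>0\<close>
  (\<open>ge_tangent_plane_if_gradients_collinear\<close>). Then \<open>u\<close> lies strictly above an affine function which
  it touches at the origin in the lower limit, against the strong minimum principle
  (\<open>distr_superharmonic_not_above_affine_touching\<close>).

  Both facts about superharmonic functions come from one comparison principle across an isolated
  point (\<open>distr_superharmonic_ge_across_isolated_point\<close>), in which a small multiple of the logarithm
  makes the point negligible; this is where the dimension has to be at least \<open>2\<close>. It rests on the fact that
  a distributionally superharmonic function cannot be touched from below by a quadratic
  polynomial with positive Laplacian
  (\<open>distr_superharmonic_no_subharmonic_minorant_touching\<close>), which is shown by
  averaging against a smooth bump and taking second differences at a minimum of the average.
\<close>

section \<open>Smooth bump functions\<close>

text \<open>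
  The functions \<open>exp (- 1 / t) / t ^ k\<close>, extended by \<open>0\<close> to \<open>t \<le> 0\<close>. The powers of \<open>1 / t\<close> are included
  because they appear under differentiation.
\<close>

definition flat_exp :: "nat \<Rightarrow> real \<Rightarrow> real"
  where "flat_exp k t = (if t \<le> 0 then 0 else inverse t ^ k * exp (- inverse t))"

lemma flat_exp_tendsto_0: "(flat_exp k \<longlongrightarrow> 0) (at_right 0)"
proof -
  have "((\<lambda>t. inverse t ^ k / exp (inverse t)) \<longlongrightarrow> (0::real)) (at_right 0)"
    using filterlim_compose[OF tendsto_power_div_exp_0 filterlim_inverse_at_top_right] .
  moreover have "\<forall>\<^sub>F t in at_right (0::real). inverse t ^ k / exp (inverse t) = flat_exp k t"
    by (auto simp: eventually_at_right_less flat_exp_def exp_minus divide_inverse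
        eventually_at_filter)
  ultimately show ?thesis
    using Lim_transform_eventually by blast
qed

lemma flat_exp_has_field_derivative:
  "(flat_exp k has_field_derivative (flat_exp (k + 2) t - real k * flat_exp (k + 1) t)) (at t)"
proof -
  consider "t < 0" | "t > 0" | "t = 0" by linarith
  then show ?thesis
  proof cases
    case 1
    have "((\<lambda>_. 0) has_field_derivative (flat_exp (k + 2) t - real k * flat_exp (k + 1) t)) (at t)"
      using 1 by (simp add: flat_exp_def)
    then show ?thesis
      by (rule has_field_derivative_transform_within_open[where S = "{..<0}"])
        (use 1 in \<open>auto simp: flat_exp_def\<close>)
  next
    case 2
    have "((\<lambda>t. inverse t ^ k * exp (- inverse t)) has_field_derivative
        (flat_exp (k + 2) t - real k * flat_exp (k + 1) t)) (at t)"
    proof -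
      have *: "real k * inverse t ^ (k - Suc 0) * (inverse t)\<^sup>2 = real k * inverse t ^ (k + 1)"
        by (cases k) (auto simp: power2_eq_square)
      have "((\<lambda>t. inverse t ^ k * exp (- inverse t)) has_field_derivative
          - (real k * inverse t ^ (k - Suc 0) * (inverse t)\<^sup>2) * exp (- inverse t)
          + inverse t ^ (k + 2) * exp (- inverse t)) (at t)"
        using 2 by (auto intro!: derivative_eq_intros simp: power2_eq_square)
      then show ?thesis
        unfolding * using 2 by (simp add: flat_exp_def algebra_simps)
    qed
    then show ?thesis
      by (rule has_field_derivative_transform_within_open[where S = "{0<..}"])
        (use 2 in \<open>auto simp: flat_exp_def\<close>)
  next
    case 3
    have r: "((\<lambda>h. (flat_exp k h - flat_exp k 0) / (h - 0)) \<longlongrightarrow> 0) (at_right 0)"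
      by (rule Lim_transform_eventually[OF flat_exp_tendsto_0[of "Suc k"]])
        (auto simp: eventually_at_filter flat_exp_def field_simps)
    have l: "((\<lambda>h. (flat_exp k h - flat_exp k 0) / (h - 0)) \<longlongrightarrow> 0) (at_left 0)"
      by (rule Lim_transform_eventually[OF tendsto_const])
        (auto simp: eventually_at_filter flat_exp_def)
    have "(flat_exp k has_field_derivative 0) (at 0)"
      unfolding has_field_derivative_iff using filterlim_split_at[OF l r] by simp
    then show ?thesis using 3 by (simp add: flat_exp_def)
  qed
qed

text \<open>
  A class of functions that contains the bump below and is closed under directional derivatives.
  Closure alone gives derivatives of every order.
\<close>

inductive bump_algebra :: "'a::euclidean_space \<Rightarrow> real \<Rightarrow> ('a \<Rightarrow> real) \<Rightarrow> bool"
  for c :: 'a and s :: real where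
  flat: "bump_algebra c s (\<lambda>x. flat_exp k (s\<^sup>2 - (x - c) \<bullet> (x - c)))"
| coord: "bump_algebra c s (\<lambda>x. (x - c) \<bullet> i)"
| const: "bump_algebra c s (\<lambda>_. a)"
| add: "bump_algebra c s f \<Longrightarrow> bump_algebra c s g \<Longrightarrow> bump_algebra c s (\<lambda>x. f x + g x)"
| mult: "bump_algebra c s f \<Longrightarrow> bump_algebra c s g \<Longrightarrow> bump_algebra c s (\<lambda>x. f x * g x)"

lemma bump_algebra_derivative:
  assumes "bump_algebra c s f"
  shows "\<exists>D. \<forall>x. (f has_derivative D x) (at x) \<and> (\<forall>i. bump_algebra c s (\<lambda>x. D x i))"
  using assms
proof induction
  case (flat k)
  define D where "D x = (\<lambda>h. (flat_exp (k + 2) (s\<^sup>2 - (x - c) \<bullet> (x - c))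
      + (- real k) * flat_exp (k + 1) (s\<^sup>2 - (x - c) \<bullet> (x - c))) * ((-2) * ((x - c) \<bullet> h)))" for x :: 'a
  have d: "((\<lambda>x. flat_exp k (s\<^sup>2 - (x - c) \<bullet> (x - c))) has_derivative D x) (at x)" for x
  proof -
    have "((\<lambda>x. s\<^sup>2 - (x - c) \<bullet> (x - c)) has_derivative (\<lambda>h. (-2) * ((x - c) \<bullet> h))) (at x)"
      by (auto intro!: derivative_eq_intros simp: inner_commute algebra_simps)
    from has_derivative_compose[OF this
        flat_exp_has_field_derivative[of k, THEN has_field_derivative_imp_has_derivative]]
    show ?thesis
      unfolding D_def by (simp add: algebra_simps)
  qed
  have "bump_algebra c s (\<lambda>x. D x i)" for i
    unfolding D_def
    by (intro bump_algebra.intros)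
  then show ?case using d by blast
next
  case (coord i)
  have "((\<lambda>x. (x - c) \<bullet> i) has_derivative (\<lambda>h. h \<bullet> i)) (at x)" for x
    by (auto intro!: derivative_eq_intros)
  moreover have "\<forall>j. bump_algebra c s (\<lambda>x. j \<bullet> i)"
    by (intro allI bump_algebra.const)
  ultimately show ?case by (intro exI[where x = "\<lambda>x h. h \<bullet> i"]) auto
next
  case (const a)
  show ?case
    by (intro exI[where x = "\<lambda>x h. 0"]) (auto intro: bump_algebra.const)
next
  case (add f g)
  then obtain D E where
    "\<forall>x. (f has_derivative D x) (at x) \<and> (\<forall>i. bump_algebra c s (\<lambda>x. D x i))"
    "\<forall>x. (g has_derivative E x) (at x) \<and> (\<forall>i. bump_algebra c s (\<lambda>x. E x i))" by blast
  then show ?case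
    by (intro exI[where x = "\<lambda>x h. D x h + E x h"])
      (auto intro!: bump_algebra.add derivative_intros)
next
  case (mult f g)
  then obtain D E where
    "\<forall>x. (f has_derivative D x) (at x) \<and> (\<forall>i. bump_algebra c s (\<lambda>x. D x i))"
    "\<forall>x. (g has_derivative E x) (at x) \<and> (\<forall>i. bump_algebra c s (\<lambda>x. E x i))" by blast
  with mult.hyps show ?case
    by (intro exI[where x = "\<lambda>x h. f x * E x h + D x h * g x"])
      (auto intro!: bump_algebra.add bump_algebra.mult has_derivative_mult)
qed

lemma bump_algebra_Ck_on: "bump_algebra c s f \<Longrightarrow> Ck_on k UNIV f"
proof (induction k arbitrary: f)
  case 0
  then obtain D where "\<forall>x. (f has_derivative D x) (at x)"
    using bump_algebra_derivative by blast
  then show ?case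
    by (auto intro!: continuous_at_imp_continuous_on has_derivative_continuous)
next
  case (Suc k)
  then obtain D where D: "\<And>x. (f has_derivative D x) (at x)" "\<And>i. bump_algebra c s (\<lambda>x. D x i)"
    using bump_algebra_derivative by blast
  have "partial_deriv i f = (\<lambda>x. D x i)" for i
    using frechet_derivative_at[OF D(1)] by (auto simp: partial_deriv_def)
  with D Suc.IH show ?case
    by (auto simp: differentiable_def)
qed

definition bump :: "'a::euclidean_space \<Rightarrow> real \<Rightarrow> 'a \<Rightarrow> real"
  where "bump c s x = flat_exp 0 (s\<^sup>2 - (x - c) \<bullet> (x - c))"

lemma bump_nonneg: "0 \<le> bump c s x"
  by (simp add: bump_def flat_exp_def)

lemma bump_eq_0_iff: "s > 0 \<Longrightarrow> bump c s x = 0 \<longleftrightarrow> s \<le> dist x c"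
  by (auto simp: bump_def flat_exp_def dist_norm dot_square_norm abs_le_square_iff[symmetric])

lemma bump_translate: "bump (c + h) s x = bump c s (x - h)"
  by (simp add: bump_def algebra_simps)

lemma Ck_on_bump: "Ck_on k UNIV (bump c s)"
  using bump_algebra_Ck_on[OF bump_algebra.flat[of c s 0]] by (simp add: bump_def[abs_def])

lemma continuous_on_bump [continuous_intros]: "continuous_on S (bump c s)"
  using Ck_on_bump[of 0 c s] continuous_on_subset by auto

text \<open>
  The distributional inequality is applied to these test functions only.
\<close>

lemma test_function_bump:
  assumes "s > 0" "cball c s \<subseteq> U"
  shows "test_function U (bump c s)"
proof -
  have "{x. bump c s x \<noteq> 0} \<subseteq> cball c s"
    using assms by (auto simp: bump_eq_0_iff dist_commute)
  then have *: "closure {x. bump c s x \<noteq> 0} \<subseteq> cball c s"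
    by (simp add: closure_minimal)
  then have "compact (closure {x. bump c s x \<noteq> 0})"
    by (meson bounded_cball bounded_subset closed_closure compact_eq_bounded_closed)
  then show ?thesis
    using * assms Ck_on_bump unfolding test_function_def by blast
qed

lemma integral_translate:
  fixes f :: "'a::euclidean_space \<Rightarrow> real"
  assumes [measurable]: "f \<in> borel_measurable borel"
  shows "(\<integral>z. f (z - h) \<partial>lborel) = (\<integral>z. f z \<partial>lborel)"
proof -
  have "(\<integral>z. f z \<partial>lborel) = (\<integral>z. f z \<partial>(distr lborel borel ((+) (- h))))"
    by (simp add: lborel_distr_plus)
  also have "\<dots> = (\<integral>z. f ((- h) + z) \<partial>lborel)"
    by (subst integral_distr) auto
  finally show ?thesis by (simp add: algebra_simps)
qed

lemma integrable_bump:
  assumes "s > 0"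
  shows "integrable lborel (bump c s)"
proof -
  have "integrable lborel (\<lambda>z. indicator (cball c s) z *\<^sub>R bump c s z)"
    by (rule borel_integrable_compact) (auto intro: continuous_intros)
  moreover have "(\<lambda>z. indicator (cball c s) z *\<^sub>R bump c s z) = bump c s"
    using assms by (auto simp: indicator_def fun_eq_iff bump_eq_0_iff dist_commute)
  ultimately show ?thesis by simp
qed

lemma integral_bump_pos:
  assumes "s > 0"
  shows "(\<integral>z. bump c s z \<partial>lborel) > 0"
proof -
  have "(\<integral>z. bump c s z \<partial>lborel) \<noteq> 0"
  proof
    assume "(\<integral>z. bump c s z \<partial>lborel) = 0"
    then have "AE z in lborel. bump c s z = 0"
      using integral_nonneg_eq_0_iff_AE[OF integrable_bump[OF assms, of c]] bump_nonneg by auto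
    moreover have "{z \<in> space lborel. \<not> bump c s z = 0} = ball c s"
      using assms by (auto simp: bump_eq_0_iff dist_commute)
    ultimately have "emeasure lborel (ball c s) = 0"
      by (simp add: AE_iff_measurable[OF _ refl])
    then show False
      using content_ball_pos[OF assms, of c] by (simp add: measure_def)
  qed
  moreover have "(\<integral>z. bump c s z \<partial>lborel) \<ge> 0"
    by (simp add: bump_nonneg)
  ultimately show ?thesis by linarith
qed

section \<open>Second differences of averages\<close>

lemma integrable_mult_continuous:
  fixes f g :: "'a::euclidean_space \<Rightarrow> real"
  assumes "integrable lborel f" "compact K" "\<forall>z. z \<notin> K \<longrightarrow> f z = 0" "continuous_on UNIV g"
  shows "integrable lborel (\<lambda>z. f z * g z)"
proof -
  have "compact (g ` K)"
    using assms by (meson compact_continuous_image continuous_on_subset subset_UNIV)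
  then obtain C where "\<forall>y\<in>g ` K. norm y \<le> C"
    using compact_imp_bounded bounded_iff by blast
  then have C: "\<bar>g z\<bar> \<le> C" if "z \<in> K" for z
    using that by auto
  have [measurable]: "g \<in> borel_measurable borel" "f \<in> borel_measurable borel"
    using assms borel_measurable_continuous_onI borel_measurable_integrable by auto
  show ?thesis
  proof (rule Bochner_Integration.integrable_bound)
    show "integrable lborel (\<lambda>z. C * f z)" using assms by simp
    show "AE z in lborel. norm (f z * g z) \<le> norm (C * f z)"
    proof (rule AE_I2)
      fix z
      show "norm (f z * g z) \<le> norm (C * f z)"
        using mult_right_mono[OF order_trans[OF C abs_ge_self], of z "\<bar>f z\<bar>"] assms(3)[rule_format, of z]
        by (cases "z \<in> K") (auto simp: abs_mult mult.commute)
    qed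
  qed simp
qed

text \<open>
  The second-order Taylor formula at \<open>0\<close> for the even function \<open>t \<mapsto> f t + f (- t)\<close>, whose first derivative
  vanishes at \<open>0\<close>.
\<close>

lemma second_difference_mean_value:
  fixes f :: "real \<Rightarrow> real"
  assumes "h > 0"
    and f': "\<And>t. (f has_real_derivative f' t) (at t)"
    and f'': "\<And>t. (f' has_real_derivative f'' t) (at t)"
  shows "\<exists>t. 0 < t \<and> t < h \<and> f h + f (- h) - 2 * f 0 = h\<^sup>2 * ((f'' t + f'' (- t)) / 2)"
proof -
  define k where "k m = (if m = 0 then (\<lambda>t. f t + f (- t))
      else if m = 1 then (\<lambda>t. f' t - f' (- t)) else (\<lambda>t. f'' t + f'' (- t)))" for m :: nat
  have r: "((\<lambda>t. g (- t)) has_real_derivative - g' (- t)) (at t)"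
    if "\<And>t. (g has_real_derivative g' t) (at t)" for g g' :: "real \<Rightarrow> real" and t
  proof -
    have "(uminus has_real_derivative -1) (at t)"
      by (auto intro!: derivative_eq_intros)
    from DERIV_chain2[where f = g and g = uminus, OF that[of "- t"] this] show ?thesis
      by simp
  qed
  have "(k m has_real_derivative k (Suc m) t) (at t)" if "m < 2" for m t
  proof -
    have "m = 0 \<or> m = 1" using that by auto
    with DERIV_add[OF f' r[OF f'], of t] DERIV_diff[OF f'' r[OF f''], of t]
    show ?thesis by (auto simp: k_def)
  qed
  then obtain t where "t > 0" "t < h" "k 0 h = (\<Sum>m<2. k m 0 / fact m * h ^ m) + k 2 t / fact 2 * h ^ 2"
    using Maclaurin[of h 2 k "k 0"] \<open>h > 0\<close> by auto
  then show ?thesis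
    by (intro exI[of _ t]) (auto simp: k_def numeral_2_eq_2 algebra_simps)
qed

lemma Ck_on_2_line_derivatives:
  assumes "Ck_on 2 UNIV \<eta>" "i \<in> Basis"
  shows "((\<lambda>t. \<eta> (z + t *\<^sub>R i)) has_real_derivative partial_deriv i \<eta> (z + t *\<^sub>R i)) (at t)"
    and "((\<lambda>t. partial_deriv i \<eta> (z + t *\<^sub>R i)) has_real_derivative
           partial_deriv i (partial_deriv i \<eta>) (z + t *\<^sub>R i)) (at t)"
    and "continuous_on UNIV (partial_deriv i (partial_deriv i \<eta>))"
    and "continuous_on UNIV \<eta>"
proof -
  have line: "((\<lambda>t. f (z + t *\<^sub>R i)) has_real_derivative partial_deriv i f (z + t *\<^sub>R i)) (at t)"
    if "\<And>x. f differentiable (at x)" for f :: "'a \<Rightarrow> real" and t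
  proof -
    have f: "(f has_derivative frechet_derivative f (at (z + t *\<^sub>R i))) (at (z + t *\<^sub>R i))"
      using that frechet_derivative_works by blast
    have "((\<lambda>t. z + t *\<^sub>R i) has_derivative (\<lambda>h. h *\<^sub>R i)) (at t)"
      by (auto intro!: derivative_eq_intros)
    from has_derivative_compose[OF this f] show ?thesis
      by (simp add: has_field_derivative_def partial_deriv_def mult.commute[of _ "frechet_derivative _ _ _"]
          linear_cmul[OF has_derivative_linear[OF f]] mult_commute_abs)
  qed
  have d: "\<And>x. \<eta> differentiable (at x)" "\<And>x. partial_deriv i \<eta> differentiable (at x)"
    using assms by (auto simp: numeral_2_eq_2)
  show "((\<lambda>t. \<eta> (z + t *\<^sub>R i)) has_real_derivative partial_deriv i \<eta> (z + t *\<^sub>R i)) (at t)"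
    and "((\<lambda>t. partial_deriv i \<eta> (z + t *\<^sub>R i)) has_real_derivative
           partial_deriv i (partial_deriv i \<eta>) (z + t *\<^sub>R i)) (at t)"
    using line d by blast+
  show "continuous_on UNIV (partial_deriv i (partial_deriv i \<eta>))"
    using assms by (auto simp: numeral_2_eq_2)
  show "continuous_on UNIV \<eta>"
    using d(1) by (simp add: continuous_at_imp_continuous_on differentiable_imp_continuous_within)
qed

text \<open>
  Differentiation under the integral sign, in the only form needed: the second differences of \<open>\<eta>\<close>
  converge pointwise and are bounded on the compact set \<open>K\<close> by the mean value form above,
  so dominated convergence applies.
\<close>

lemma second_difference_weighted_integral_tendsto:
  fixes f \<eta> :: "'a::euclidean_space \<Rightarrow> real"
  assumes f: "integrable lborel f" "compact K" "\<forall>z. z \<notin> K \<longrightarrow> f z = 0"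
    and \<eta>: "Ck_on 2 UNIV \<eta>" and i: "i \<in> Basis"
    and h: "\<And>n. 0 < h n" "\<And>n. h n \<le> 1" "h \<longlonglongrightarrow> 0"
  shows "(\<lambda>n. ((\<integral>z. f z * \<eta> (z + h n *\<^sub>R i) \<partial>lborel) + (\<integral>z. f z * \<eta> (z - h n *\<^sub>R i) \<partial>lborel)
            - 2 * (\<integral>z. f z * \<eta> z \<partial>lborel)) / (h n)\<^sup>2)
          \<longlonglongrightarrow> (\<integral>z. f z * partial_deriv i (partial_deriv i \<eta>) z \<partial>lborel)"
proof -
  note D = Ck_on_2_line_derivatives[OF \<eta> i]
  define \<eta>'' where "\<eta>'' = partial_deriv i (partial_deriv i \<eta>)"
  define q where "q n z = (\<eta> (z + h n *\<^sub>R i) + \<eta> (z - h n *\<^sub>R i) - 2 * \<eta> z) / (h n)\<^sup>2" for n z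
  have mv: "\<exists>t. 0 < t \<and> t < h n \<and> q n z = (\<eta>'' (z + t *\<^sub>R i) + \<eta>'' (z - t *\<^sub>R i)) / 2" for n z
    using second_difference_mean_value[OF h(1)[of n] D(1,2)[of z]] h(1)[of n]
    by (auto simp: q_def \<eta>''_def)
  have cont: "continuous_on UNIV \<eta>''" using D by (simp add: \<eta>''_def)
  have q_lim: "(\<lambda>n. q n z) \<longlonglongrightarrow> \<eta>'' z" for z
  proof -
    obtain t where t: "\<And>n. 0 < t n \<and> t n < h n \<and> q n z = (\<eta>'' (z + t n *\<^sub>R i) + \<eta>'' (z - t n *\<^sub>R i)) / 2"
      using mv[of _ z] by metis
    have t0: "t \<longlonglongrightarrow> 0"
      by (rule tendsto_sandwich[OF _ _ tendsto_const h(3)]) (use t less_imp_le in \<open>auto intro!: always_eventually\<close>)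
    have c: "isCont \<eta>'' z" using cont by (simp add: continuous_on_eq_continuous_at)
    have "(\<lambda>n. \<eta>'' (z + t n *\<^sub>R i)) \<longlonglongrightarrow> \<eta>'' z" "(\<lambda>n. \<eta>'' (z - t n *\<^sub>R i)) \<longlonglongrightarrow> \<eta>'' z"
      by (rule isCont_tendsto_compose[OF c]; use t0 in \<open>auto intro!: tendsto_eq_intros\<close>)+
    then have "(\<lambda>n. (\<eta>'' (z + t n *\<^sub>R i) + \<eta>'' (z - t n *\<^sub>R i)) / 2) \<longlonglongrightarrow> (\<eta>'' z + \<eta>'' z) / 2"
      by (intro tendsto_intros) auto
    moreover have "(\<lambda>n. q n z) = (\<lambda>n. (\<eta>'' (z + t n *\<^sub>R i) + \<eta>'' (z - t n *\<^sub>R i)) / 2)"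
      using t by blast
    ultimately show ?thesis by simp
  qed
  obtain R where "\<forall>z\<in>K. norm z \<le> R"
    using compact_imp_bounded[OF f(2)] bounded_iff by blast
  then have R: "norm z \<le> R" if "z \<in> K" for z
    using that by auto
  have "compact (\<eta>'' ` cball 0 (R + 1))"
    by (intro compact_continuous_image continuous_on_subset[OF cont]) auto
  then obtain C where "\<forall>y\<in>\<eta>'' ` cball 0 (R + 1). norm y \<le> C"
    using compact_imp_bounded bounded_iff by blast
  then have C: "\<bar>\<eta>'' z\<bar> \<le> C" if "norm z \<le> R + 1" for z
    using that by auto
  have q_bound: "\<bar>q n z\<bar> \<le> C" if z: "z \<in> K" for n z
  proof -
    obtain t where t: "0 < t" "t < h n" "q n z = (\<eta>'' (z + t *\<^sub>R i) + \<eta>'' (z - t *\<^sub>R i)) / 2"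
      using mv by blast
    have "norm (z + t *\<^sub>R i) \<le> R + 1" "norm (z - t *\<^sub>R i) \<le> R + 1"
      using R[OF z] norm_triangle_ineq[of z "t *\<^sub>R i"] norm_triangle_ineq4[of z "t *\<^sub>R i"] t h(2)[of n] i
      by auto
    from C[OF this(1)] C[OF this(2)] show ?thesis unfolding t(3) by (auto simp: abs_le_iff)
  qed
  have \<eta>c: "continuous_on UNIV (\<lambda>z. \<eta> (z + w))" for w
    by (intro continuous_on_compose2[OF D(4)] continuous_intros) auto
  have qc: "continuous_on UNIV (q n)" for n
    unfolding q_def using \<eta>c[of "h n *\<^sub>R i"] \<eta>c[of "- h n *\<^sub>R i"] D(4) h(1)[of n]
    by (auto intro!: continuous_intros)
  note int = integrable_mult_continuous[OF f]
  have "((\<integral>z. f z * \<eta> (z + h n *\<^sub>R i) \<partial>lborel) + (\<integral>z. f z * \<eta> (z - h n *\<^sub>R i) \<partial>lborel)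
            - 2 * (\<integral>z. f z * \<eta> z \<partial>lborel)) / (h n)\<^sup>2 = (\<integral>z. f z * q n z \<partial>lborel)" for n
  proof -
    have "(\<integral>z. f z * q n z \<partial>lborel) = (\<integral>z. (f z * \<eta> (z + h n *\<^sub>R i) + f z * \<eta> (z - h n *\<^sub>R i)
            - 2 * (f z * \<eta> z)) / (h n)\<^sup>2 \<partial>lborel)"
      by (intro Bochner_Integration.integral_cong) (auto simp: q_def algebra_simps)
    also have "\<dots> = ((\<integral>z. f z * \<eta> (z + h n *\<^sub>R i) \<partial>lborel) + (\<integral>z. f z * \<eta> (z - h n *\<^sub>R i) \<partial>lborel)
            - 2 * (\<integral>z. f z * \<eta> z \<partial>lborel)) / (h n)\<^sup>2"
      using int[OF \<eta>c[of "h n *\<^sub>R i"]] int[OF \<eta>c[of "- h n *\<^sub>R i"]] int[OF D(4)] by simp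
    finally show ?thesis by simp
  qed
  moreover have "(\<lambda>n. \<integral>z. f z * q n z \<partial>lborel) \<longlonglongrightarrow> (\<integral>z. f z * \<eta>'' z \<partial>lborel)"
  proof (rule integral_dominated_convergence[where w = "\<lambda>z. C * \<bar>f z\<bar>"])
    show "(\<lambda>z. f z * \<eta>'' z) \<in> borel_measurable lborel"
      using int[OF cont] borel_measurable_integrable by blast
    show "(\<lambda>z. f z * q n z) \<in> borel_measurable lborel" for n
      using int[OF qc] borel_measurable_integrable by blast
    show "integrable lborel (\<lambda>z. C * \<bar>f z\<bar>)" using f(1) by simp
    show "AE z in lborel. (\<lambda>n. f z * q n z) \<longlonglongrightarrow> f z * \<eta>'' z"
      using q_lim by (auto intro!: AE_I2 tendsto_intros)
    show "AE z in lborel. norm (f z * q n z) \<le> C * \<bar>f z\<bar>" for n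
    proof (rule AE_I2)
      fix z
      show "norm (f z * q n z) \<le> C * \<bar>f z\<bar>"
        using q_bound[of z n] f(3)[rule_format, of z] mult_right_mono[of "\<bar>q n z\<bar>" C "\<bar>f z\<bar>"]
        by (cases "z \<in> K") (auto simp: abs_mult mult.commute)
    qed
  qed
  ultimately show ?thesis by (simp add: \<eta>''_def)
qed

text \<open>
  Continuity makes the average attain its minimum on a compact ball.
\<close>

lemma continuous_mollification:
  fixes f :: "'a::euclidean_space \<Rightarrow> real"
  assumes f: "integrable lborel f"
  shows "continuous_on UNIV (\<lambda>c. \<integral>z. f z * bump c \<tau> z \<partial>lborel)"
proof (rule continuous_at_imp_continuous_on, intro ballI)
  fix c :: 'a
  have b1: "\<bar>bump c \<tau> z\<bar> \<le> 1" for c z :: 'a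
    by (auto simp: bump_def flat_exp_def)
  have [measurable]: "f \<in> borel_measurable borel" 
    using assms borel_measurable_integrable by auto
  have [measurable]: "bump c \<tau> \<in> borel_measurable borel" for c :: 'a
    by (intro borel_measurable_continuous_onI continuous_on_bump)
  show "isCont (\<lambda>c. \<integral>z. f z * bump c \<tau> z \<partial>lborel) c"
  proof (rule continuous_at_sequentiallyI)
    fix s :: "nat \<Rightarrow> 'a" assume s: "s \<longlonglongrightarrow> c"
    show "(\<lambda>n. \<integral>z. f z * bump (s n) \<tau> z \<partial>lborel) \<longlonglongrightarrow> (\<integral>z. f z * bump c \<tau> z \<partial>lborel)"
    proof (rule integral_dominated_convergence[where w = "\<lambda>z. \<bar>f z\<bar>"])
      have "(\<lambda>n. bump (s n) \<tau> z) \<longlonglongrightarrow> bump c \<tau> z" for z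
      proof -
        have *: "bump c \<tau> z = bump 0 \<tau> (z - c)" for c using bump_translate[of 0 c] by simp
        have "isCont (bump 0 \<tau>) (z - c)"
          using continuous_on_bump[of UNIV "0::'a" \<tau>] by (simp add: continuous_on_eq_continuous_at)
        then show ?thesis
          unfolding *[of "s _"] *[of c] by (rule isCont_tendsto_compose) (intro tendsto_intros s)
      qed
      then show "AE z in lborel. (\<lambda>n. f z * bump (s n) \<tau> z) \<longlonglongrightarrow> f z * bump c \<tau> z"
        by (auto intro!: AE_I2 tendsto_intros)
      show "AE z in lborel. norm (f z * bump (s n) \<tau> z) \<le> \<bar>f z\<bar>" for n
        using b1 by (auto intro!: AE_I2 simp: abs_mult mult_left_le)
    qed (use f in auto)
  qed
qed

section \<open>Quadratic functions touching a superharmonic function\<close>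

text \<open>
  For a quadratic polynomial \<open>T\<close> the second differences along the axes are exact multiples of \<open>h\<^sup>2\<close>, and
  \<open>a i\<close> is its pure second derivative in direction \<open>i\<close>; the sum of \<open>a\<close> over the basis is the
  Laplacian of \<open>T\<close>. Exactness matters because translation moves a second
  difference from the weight to \<open>T\<close>, and the integral is then known without an error term.
\<close>

definition pure_second_derivs :: "('a::euclidean_space \<Rightarrow> real) \<Rightarrow> ('a \<Rightarrow> real) \<Rightarrow> bool"
  where "pure_second_derivs T a \<longleftrightarrow> continuous_on UNIV T \<and>
    (\<forall>i\<in>Basis. \<forall>y h. T (y + h *\<^sub>R i) + T (y - h *\<^sub>R i) - 2 * T y = h\<^sup>2 * a i)"

lemma pure_second_derivs_add:
  assumes "pure_second_derivs S a" "pure_second_derivs T b"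
  shows "pure_second_derivs (\<lambda>y. S y + T y) (\<lambda>i. a i + b i)"
proof -
  have "(S (y + h *\<^sub>R i) + T (y + h *\<^sub>R i)) + (S (y - h *\<^sub>R i) + T (y - h *\<^sub>R i)) - 2 * (S y + T y)
      = h\<^sup>2 * (a i + b i)" if "i \<in> Basis" for y h i
  proof -
    have "S (y + h *\<^sub>R i) + S (y - h *\<^sub>R i) - 2 * S y = h\<^sup>2 * a i"
      "T (y + h *\<^sub>R i) + T (y - h *\<^sub>R i) - 2 * T y = h\<^sup>2 * b i"
      using assms that by (auto simp: pure_second_derivs_def)
    then show ?thesis by (simp add: algebra_simps)
  qed
  then show ?thesis
    using assms by (simp add: pure_second_derivs_def continuous_on_add)
qed

lemma pure_second_derivs_cmult:
  assumes "pure_second_derivs T a"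
  shows "pure_second_derivs (\<lambda>y. c * T y) (\<lambda>i. c * a i)"
proof -
  have "c * T (y + h *\<^sub>R i) + c * T (y - h *\<^sub>R i) - 2 * (c * T y)
     = c * (T (y + h *\<^sub>R i) + T (y - h *\<^sub>R i) - 2 * T y)"
    for y h i by (simp add: algebra_simps)
  then show ?thesis
    using assms unfolding pure_second_derivs_def
    by (auto intro!: continuous_intros)
qed

lemma pure_second_derivs_const: "pure_second_derivs (\<lambda>y. c) (\<lambda>i. 0)"
  by (simp add: pure_second_derivs_def)

lemma pure_second_derivs_inner: "pure_second_derivs (\<lambda>y. p \<bullet> (y - c)) (\<lambda>i. 0)"
  by (auto simp: pure_second_derivs_def inner_diff_right inner_add_right intro!: continuous_intros)

lemma pure_second_derivs_inner_square:
  "pure_second_derivs (\<lambda>y. (p \<bullet> (y - c))\<^sup>2) (\<lambda>i. 2 * (p \<bullet> i)\<^sup>2)"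
  by (auto simp: pure_second_derivs_def inner_diff_right inner_add_right power2_eq_square
      algebra_simps intro!: continuous_intros)

lemma pure_second_derivs_norm_square:
  "pure_second_derivs (\<lambda>y. (norm (y - c))\<^sup>2) (\<lambda>i. 2)"
proof -
  have "(norm (y + h *\<^sub>R i - c))\<^sup>2 + (norm (y - h *\<^sub>R i - c))\<^sup>2 - 2 * (norm (y - c))\<^sup>2 = h\<^sup>2 * 2"
    if "i \<in> Basis" for y h and i :: 'a
  proof -
    have "y + h *\<^sub>R i - c = (y - c) + h *\<^sub>R i" "y - h *\<^sub>R i - c = (y - c) - h *\<^sub>R i" by auto
    then show ?thesis
      using that by (simp only: power2_norm_eq_inner inner_add_left inner_add_right inner_diff_left
          inner_diff_right inner_scaleR_left inner_scaleR_right)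
        (simp add: inner_commute power2_eq_square algebra_simps)
  qed
  then show ?thesis
    by (auto simp: pure_second_derivs_def intro!: continuous_intros)
qed

lemma laplacian_eq_0_outside_support:
  assumes "\<And>z. z \<notin> K \<Longrightarrow> \<eta> z = 0" "closed K" "z \<notin> K"
  shows "laplacian \<eta> z = 0"
proof -
  have zero: "partial_deriv i f z = 0" if "\<And>z. z \<notin> K \<Longrightarrow> f z = 0" "z \<notin> K"
    for i z and f :: "'a \<Rightarrow> real"
  proof -
    have "((\<lambda>_. 0) has_derivative (\<lambda>_. 0)) (at z)" by simp
    then have "(f has_derivative (\<lambda>_. 0)) (at z)"
      by (rule has_derivative_transform_within_open[where s = "- K"]) (use that assms in auto)
    from frechet_derivative_at[OF this] show ?thesis
      by (metis partial_deriv_def)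
  qed
  have "partial_deriv i (partial_deriv i \<eta>) z = 0" for i
    using zero assms by metis
  then show ?thesis by (simp add: laplacian_def)
qed

text \<open>
  Superharmonicity in the distribution sense implies superharmonicity in the viscosity sense.
  After \<open>T\<close> is lowered by a small multiple of the squared distance to \<open>y1\<close>, the minimum of the
  difference \<open>g\<close> at \<open>y1\<close> is strict and the Laplacian is still positive. The averages \<open>G\<close> of \<open>g\<close> against a
  narrow bump then have an interior minimum \<open>y2\<close>. There the second differences of \<open>G\<close> are nonnegative,
  so the integral of \<open>g\<close> against the Laplacian of the bump is nonnegative. But the contribution of \<open>u\<close>
  to this integral is at most \<open>0\<close> by hypothesis, and the polynomial contributes a strictly negative term.
\<close>

lemma distr_superharmonic_no_subharmonic_minorant_touching:
  fixes u T :: "'a::euclidean_space \<Rightarrow> real"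
  assumes "open U" and u: "continuous_on U u" and super: "laplacian_nonpos_distr U u"
    and y1: "y1 \<in> U" and T: "pure_second_derivs T a"
    and pos: "(\<Sum>i\<in>(Basis::'a set). a i) > 0"
    and "d > 0" and touch: "\<And>y. y \<in> U \<Longrightarrow> dist y y1 < d \<Longrightarrow> u y1 - T y1 \<le> u y - T y"
  shows False
proof -
  define N where "N = real DIM('a)"
  have N: "N > 0" by (simp add: N_def)
  \<comment> \<open>With this choice the Laplacian drops from the sum of \<open>a\<close> to half of it.\<close>
  define \<kappa> where "\<kappa> = (\<Sum>i\<in>(Basis::'a set). a i) / (4 * N)"
  have \<kappa>: "\<kappa> > 0" using pos N by (simp add: \<kappa>_def)
  define S where "S y = T y + (- \<kappa>) * (norm (y - y1))\<^sup>2" for y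
  define b where "b i = a i + (- \<kappa>) * 2" for i :: 'a
  have S: "pure_second_derivs S b"
    unfolding S_def[abs_def] b_def[abs_def]
    by (intro pure_second_derivs_add T pure_second_derivs_cmult pure_second_derivs_norm_square)
  have S_quad: "S (y + h *\<^sub>R i) + S (y - h *\<^sub>R i) - 2 * S y = h\<^sup>2 * b i" if "i \<in> Basis" for y h i
    using S that by (simp add: pure_second_derivs_def)
  have b_sum: "(\<Sum>i\<in>Basis. b i) > 0"
  proof -
    have "(\<Sum>i\<in>(Basis::'a set). b i) = (\<Sum>i\<in>(Basis::'a set). a i) - 2 * (N * \<kappa>)"
      by (simp add: b_def sum.distrib sum_subtractf N_def)
    also have "N * \<kappa> = (\<Sum>i\<in>(Basis::'a set). a i) / 4" using N by (simp add: \<kappa>_def)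
    finally show ?thesis using pos by simp
  qed
  have S_cont: "continuous_on A S" for A
    using S continuous_on_subset by (auto simp: pure_second_derivs_def)

  obtain s0 where s0: "s0 > 0" "cball y1 s0 \<subseteq> U"
    using \<open>open U\<close> y1 open_contains_cball by blast
  define s where "s = min s0 (d / 2)"
  have s: "s > 0" "cball y1 s \<subseteq> U" "s < d"
    using s0 \<open>d > 0\<close> by (auto simp: s_def)
  define K where "K = cball y1 s"
  define g where "g y = u y - S y" for y
  have g_cont: "continuous_on K g"
    unfolding g_def K_def
    by (intro continuous_intros continuous_on_subset[OF u] s S_cont)
  have g_min: "g y1 + \<kappa> * (dist z y1)\<^sup>2 \<le> g z" if "z \<in> K" for z
    using touch[of z] that s by (auto simp: g_def S_def K_def dist_norm norm_minus_commute)
  have "continuous (at y1 within K) g"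
    using g_cont s(1) by (simp add: continuous_on_eq_continuous_within K_def)
  moreover have "\<kappa> * (s / 4)\<^sup>2 / 2 > 0" using \<kappa> s by simp
  ultimately obtain \<tau>0 where \<tau>0: "\<tau>0 > 0"
    "\<And>z. z \<in> K \<Longrightarrow> dist z y1 < \<tau>0 \<Longrightarrow> dist (g z) (g y1) < \<kappa> * (s / 4)\<^sup>2 / 2"
    unfolding continuous_within_eps_delta by meson
  \<comment> \<open>The bump is so narrow that \<open>G\<close> at the centre stays below its values at distance \<open>s / 2\<close>.\<close>
  define \<tau> where "\<tau> = min \<tau>0 (s / 4)"
  have \<tau>: "\<tau> > 0" "\<tau> \<le> s / 4" "\<tau> \<le> \<tau>0" using \<tau>0 s by (auto simp: \<tau>_def)
  define J where "J = (\<integral>z. bump 0 \<tau> (z::'a) \<partial>lborel)"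
  have bm [measurable]: "bump c \<tau> \<in> borel_measurable borel" for c :: 'a
    by (intro borel_measurable_continuous_onI continuous_on_bump)
  have J: "J > 0" "\<And>c::'a. (\<integral>z. bump c \<tau> z \<partial>lborel) = J"
  proof -
    show "J > 0" unfolding J_def using \<tau> by (intro integral_bump_pos)
    show "(\<integral>z. bump c \<tau> z \<partial>lborel) = J" for c :: 'a
      using integral_translate[OF bm[of 0], of c] bump_translate[of 0 c \<tau>] by (simp add: J_def)
  qed
  \<comment> \<open>Cutting off at \<open>K\<close> changes no average with centre within \<open>3 * s / 4\<close> of \<open>y1\<close> and makes the integrands integrable.\<close>
  define fu where "fu z = indicator K z * u z" for z
  define fS where "fS z = indicator K z * S z" for z
  define f where "f z = fu z - fS z" for z
  have K: "compact K" by (simp add: K_def)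
  have fu: "integrable lborel fu" "\<forall>z. z \<notin> K \<longrightarrow> fu z = 0"
    using borel_integrable_compact[OF K, of u] continuous_on_subset[OF u] s(2)
    by (auto simp: fu_def[abs_def] K_def)
  have fS: "integrable lborel fS" "\<forall>z. z \<notin> K \<longrightarrow> fS z = 0"
    using borel_integrable_compact[OF K, of S] S_cont by (auto simp: fS_def[abs_def])
  have f: "integrable lborel f" "\<forall>z. z \<notin> K \<longrightarrow> f z = 0" "\<And>z. z \<in> K \<Longrightarrow> f z = g z"
    using fu fS Bochner_Integration.integrable_diff[OF fu(1) fS(1)]
    by (simp_all add: f_def[abs_def]) (simp add: fu_def fS_def g_def)
  define G where "G c = (\<integral>z. f z * bump c \<tau> z \<partial>lborel)" for c
  have G_cont: "continuous_on A G" for A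
    unfolding G_def by (rule continuous_on_subset[OF continuous_mollification[OF f(1)]]) simp
  have f_bump: "integrable lborel (\<lambda>z. f z * bump c \<tau> z)" for c
    by (rule integrable_mult_continuous[OF f(1) K f(2) continuous_on_bump])
  have near: "z \<in> K \<and> dist z c < \<tau>" if "bump c \<tau> z \<noteq> 0" "dist c y1 \<le> s / 2 + s / 4" for z c
    using that \<tau> dist_triangle[of z y1 c] by (auto simp: bump_eq_0_iff K_def dist_commute)
  have G_ge: "A * J \<le> G c" if "dist c y1 \<le> s / 2 + s / 4" "\<And>z. z \<in> K \<Longrightarrow> dist z c < \<tau> \<Longrightarrow> A \<le> g z" for A c
  proof -
    have "A * J = (\<integral>z. A * bump c \<tau> z \<partial>lborel)" using J by simp
    also have "\<dots> \<le> G c"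
      unfolding G_def
    proof (intro integral_mono)
      show "A * bump c \<tau> z \<le> f z * bump c \<tau> z" for z
        using near[of c z] that f(3)[of z] bump_nonneg[of c \<tau> z]
        by (cases "bump c \<tau> z = 0") (auto intro: mult_right_mono)
    qed (use f_bump integrable_bump \<tau> in auto)
    finally show ?thesis .
  qed
  have G_le: "G c \<le> A * J" if "dist c y1 \<le> s / 2 + s / 4" "\<And>z. z \<in> K \<Longrightarrow> dist z c < \<tau> \<Longrightarrow> g z \<le> A" for A c
  proof -
    have "G c \<le> (\<integral>z. A * bump c \<tau> z \<partial>lborel)"
      unfolding G_def
    proof (intro integral_mono)
      show "f z * bump c \<tau> z \<le> A * bump c \<tau> z" for z
        using near[of c z] that f(3)[of z] bump_nonneg[of c \<tau> z]
        by (cases "bump c \<tau> z = 0") (auto intro: mult_right_mono)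
    qed (use f_bump integrable_bump \<tau> in auto)
    then show ?thesis using J by simp
  qed

  obtain y2 where y2: "y2 \<in> cball y1 (s / 2)" "\<And>c. c \<in> cball y1 (s / 2) \<Longrightarrow> G y2 \<le> G c"
    using continuous_attains_inf[of "cball y1 (s / 2)" G] G_cont s(1) by auto
  have "G y1 \<le> (g y1 + \<kappa> * (s / 4)\<^sup>2 / 2) * J"
  proof (rule G_le)
    fix z assume "z \<in> K" "dist z y1 < \<tau>"
    then show "g z \<le> g y1 + \<kappa> * (s / 4)\<^sup>2 / 2"
      using \<tau>0(2)[of z] \<tau> abs_ge_self[of "g z - g y1"] by (simp add: dist_real_def)
  qed (use s in simp)
  also have "\<dots> < (g y1 + \<kappa> * (s / 4)\<^sup>2) * J"
    using J \<kappa> s by simp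
  finally have G_y1: "G y1 < (g y1 + \<kappa> * (s / 4)\<^sup>2) * J" .
  have interior: "dist y2 y1 < s / 2"
  proof (rule ccontr)
    assume "\<not> dist y2 y1 < s / 2"
    then have y2': "dist y2 y1 = s / 2" using y2(1) by (simp add: dist_commute)
    have "(g y1 + \<kappa> * (s / 4)\<^sup>2) * J \<le> G y2"
    proof (rule G_ge)
      fix z assume z: "z \<in> K" "dist z y2 < \<tau>"
      have "s / 4 \<le> dist z y1"
        using dist_triangle[of y2 y1 z] z \<tau> y2' by (simp add: dist_commute)
      then have "\<kappa> * (s / 4)\<^sup>2 \<le> \<kappa> * (dist z y1)\<^sup>2"
        using \<kappa> s by (intro mult_left_mono power_mono) auto
      then show "g y1 + \<kappa> * (s / 4)\<^sup>2 \<le> g z" using g_min[OF z(1)] by linarith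
    qed (use y2' s in simp)
    moreover have "G y2 \<le> G y1" using y2(2)[of y1] s by simp
    ultimately show False using G_y1 by linarith
  qed

  define r where "r = min 1 (s / 2 - dist y2 y1)"
  have r: "r > 0" "r \<le> 1" "r \<le> s / 2 - dist y2 y1" using interior by (auto simp: r_def)
  define h where "h n = r * inverse (real (Suc n))" for n
  have h: "\<And>n. 0 < h n" "\<And>n. h n \<le> 1" "h \<longlonglongrightarrow> 0" "\<And>n. h n \<le> r"
  proof -
    show "0 < h n" for n using r by (simp add: h_def)
    show hr: "h n \<le> r" for n using r by (simp add: h_def field_simps)
    show "h n \<le> 1" for n using hr[of n] r(2) by linarith
    show "h \<longlonglongrightarrow> 0" unfolding h_def
      using tendsto_mult_right_zero[OF LIMSEQ_inverse_real_of_nat] by blast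
  qed
  define \<eta> where "\<eta> = bump y2 \<tau>"
  have \<eta>: "Ck_on 2 UNIV \<eta>" unfolding \<eta>_def by (rule Ck_on_bump)
  have \<eta>_shift: "\<eta> (z + w) = bump (y2 - w) \<tau> z" "\<eta> (z - w) = bump (y2 + w) \<tau> z" for z w
    using bump_translate[of y2 "- w" \<tau> z] bump_translate[of y2 w \<tau> z] by (simp_all add: \<eta>_def)
  have in_ball: "y2 + h n *\<^sub>R i \<in> cball y1 (s / 2)" "y2 - h n *\<^sub>R i \<in> cball y1 (s / 2)"
    if "i \<in> Basis" for n i
  proof -
    have "dist (y2 + h n *\<^sub>R i) y2 = h n" "dist (y2 - h n *\<^sub>R i) y2 = h n"
      using that h(1)[of n] by (simp_all add: dist_norm)
    then show "y2 + h n *\<^sub>R i \<in> cball y1 (s / 2)" "y2 - h n *\<^sub>R i \<in> cball y1 (s / 2)"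
      using dist_triangle[of y1 "y2 + h n *\<^sub>R i" y2] dist_triangle[of y1 "y2 - h n *\<^sub>R i" y2] h(4)[of n] r(3)
      by (auto simp: dist_commute)
  qed
  define \<eta>'' where "\<eta>'' i = partial_deriv i (partial_deriv i \<eta>)" for i
  have lap: "laplacian \<eta> z = (\<Sum>i\<in>Basis. \<eta>'' i z)" for z
    by (simp add: laplacian_def \<eta>''_def)
  have int2: "integrable lborel (\<lambda>z. F z * \<eta>'' i z)"
    if "integrable lborel F" "\<forall>z. z \<notin> K \<longrightarrow> F z = 0" "i \<in> Basis" for F i
    unfolding \<eta>''_def by (rule integrable_mult_continuous[OF that(1) K that(2)])
      (use Ck_on_2_line_derivatives(3)[OF \<eta> that(3)] in auto)

  have f_pos: "0 \<le> (\<integral>z. f z * \<eta>'' i z \<partial>lborel)" if i: "i \<in> Basis" for i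
  proof (rule LIMSEQ_le_const)
    show "(\<lambda>n. ((\<integral>z. f z * \<eta> (z + h n *\<^sub>R i) \<partial>lborel) + (\<integral>z. f z * \<eta> (z - h n *\<^sub>R i) \<partial>lborel)
            - 2 * (\<integral>z. f z * \<eta> z \<partial>lborel)) / (h n)\<^sup>2) \<longlonglongrightarrow> (\<integral>z. f z * \<eta>'' i z \<partial>lborel)"
      unfolding \<eta>''_def
      by (rule second_difference_weighted_integral_tendsto[OF f(1) K f(2) \<eta> i h(1-3)])
    have "G y2 \<le> G (y2 - h n *\<^sub>R i)" "G y2 \<le> G (y2 + h n *\<^sub>R i)" for n
      using y2(2) in_ball[OF i] by auto
    then show "\<exists>M. \<forall>n\<ge>M. 0 \<le> ((\<integral>z. f z * \<eta> (z + h n *\<^sub>R i) \<partial>lborel)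
        + (\<integral>z. f z * \<eta> (z - h n *\<^sub>R i) \<partial>lborel) - 2 * (\<integral>z. f z * \<eta> z \<partial>lborel)) / (h n)\<^sup>2"
      unfolding \<eta>_shift unfolding \<eta>_def G_def[symmetric]
      by (smt (verit, best) divide_nonneg_nonneg zero_le_power2)
  qed
  have fS_val: "(\<integral>z. fS z * \<eta>'' i z \<partial>lborel) = J * b i" if i: "i \<in> Basis" for i
  proof (rule LIMSEQ_unique)
    show "(\<lambda>n. ((\<integral>z. fS z * \<eta> (z + h n *\<^sub>R i) \<partial>lborel) + (\<integral>z. fS z * \<eta> (z - h n *\<^sub>R i) \<partial>lborel)
            - 2 * (\<integral>z. fS z * \<eta> z \<partial>lborel)) / (h n)\<^sup>2) \<longlonglongrightarrow> (\<integral>z. fS z * \<eta>'' i z \<partial>lborel)"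
      unfolding \<eta>''_def
      by (rule second_difference_weighted_integral_tendsto[OF fS(1) K fS(2) \<eta> i h(1-3)])
    have shift: "(\<integral>z. fS z * bump c \<tau> z \<partial>lborel) = (\<integral>z. S (z + c) * bump 0 \<tau> z \<partial>lborel)"
      if "c \<in> cball y1 (s / 2)" for c
    proof -
      have "(\<integral>z. fS z * bump c \<tau> z \<partial>lborel) = (\<integral>z. S ((z - c) + c) * bump 0 \<tau> (z - c) \<partial>lborel)"
      proof (intro Bochner_Integration.integral_cong refl)
        fix z
        show "fS z * bump c \<tau> z = S ((z - c) + c) * bump 0 \<tau> (z - c)"
          using near[of c z] that s bump_translate[of 0 c \<tau> z]
          by (cases "bump c \<tau> z = 0") (auto simp: fS_def dist_commute)
      qed
      also have "\<dots> = (\<integral>z. S (z + c) * bump 0 \<tau> z \<partial>lborel)"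
        by (rule integral_translate) (intro borel_measurable_continuous_onI continuous_intros
            continuous_on_compose2[OF S_cont[of UNIV]]; simp)
      finally show ?thesis .
    qed
    have S_int: "integrable lborel (\<lambda>z. S (z + c) * bump 0 \<tau> z)" for c
    proof -
      have "integrable lborel (\<lambda>z. bump 0 \<tau> z * S (z + c))"
        using \<tau> by (intro integrable_mult_continuous[of _ "cball 0 \<tau>"] integrable_bump
            continuous_on_compose2[OF S_cont[of UNIV]] continuous_intros) (auto simp: bump_eq_0_iff)
      then show ?thesis by (simp add: mult.commute)
    qed
    have "((\<integral>z. fS z * \<eta> (z + h n *\<^sub>R i) \<partial>lborel) + (\<integral>z. fS z * \<eta> (z - h n *\<^sub>R i) \<partial>lborel)
            - 2 * (\<integral>z. fS z * \<eta> z \<partial>lborel)) / (h n)\<^sup>2 = J * b i" for n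
    proof -
      have "(\<integral>z. fS z * \<eta> (z + h n *\<^sub>R i) \<partial>lborel) + (\<integral>z. fS z * \<eta> (z - h n *\<^sub>R i) \<partial>lborel)
            - 2 * (\<integral>z. fS z * \<eta> z \<partial>lborel)
          = (\<integral>z. S (z + (y2 - h n *\<^sub>R i)) * bump 0 \<tau> z \<partial>lborel)
            + (\<integral>z. S (z + (y2 + h n *\<^sub>R i)) * bump 0 \<tau> z \<partial>lborel)
            - 2 * (\<integral>z. S (z + y2) * bump 0 \<tau> z \<partial>lborel)"
        unfolding \<eta>_shift unfolding \<eta>_def using shift in_ball[OF i, of n] y2(1) by auto
      also have "\<dots> = (\<integral>z. S (z + (y2 - h n *\<^sub>R i)) * bump 0 \<tau> z + S (z + (y2 + h n *\<^sub>R i)) * bump 0 \<tau> z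
            - 2 * (S (z + y2) * bump 0 \<tau> z) \<partial>lborel)"
        using S_int by simp
      also have "\<dots> = (\<integral>z. ((h n)\<^sup>2 * b i) * bump 0 \<tau> (z::'a) \<partial>lborel)"
      proof (intro Bochner_Integration.integral_cong refl)
        fix z :: 'a
        have "S (z + (y2 - h n *\<^sub>R i)) + S (z + (y2 + h n *\<^sub>R i)) - 2 * S (z + y2) = (h n)\<^sup>2 * b i"
          using S_quad[OF i, of "z + y2" "h n"] by (simp add: algebra_simps)
        then show "S (z + (y2 - h n *\<^sub>R i)) * bump 0 \<tau> z + S (z + (y2 + h n *\<^sub>R i)) * bump 0 \<tau> z
            - 2 * (S (z + y2) * bump 0 \<tau> z) = (h n)\<^sup>2 * b i * bump 0 \<tau> z"
          by (metis (no_types, lifting) distrib_right left_diff_distrib mult.assoc)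
      qed
      also have "\<dots> = (h n)\<^sup>2 * b i * J" using J(2)[of 0] by (simp add: J_def)
      finally show ?thesis using h(1)[of n] by simp
    qed
    then show "(\<lambda>n. ((\<integral>z. fS z * \<eta> (z + h n *\<^sub>R i) \<partial>lborel) + (\<integral>z. fS z * \<eta> (z - h n *\<^sub>R i) \<partial>lborel)
            - 2 * (\<integral>z. fS z * \<eta> z \<partial>lborel)) / (h n)\<^sup>2) \<longlonglongrightarrow> J * b i"
      by simp
  qed
  have fu_neg: "(\<integral>z. fu z * laplacian \<eta> z \<partial>lborel) \<le> 0"
  proof -
    have sub: "cball y2 \<tau> \<subseteq> K"
      using interior \<tau> s by (auto simp: K_def cball_subset_cball_iff dist_commute)
    have "test_function U \<eta>"
      unfolding \<eta>_def using \<tau> sub s(2) by (intro test_function_bump) (auto simp: K_def)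
    then have "(LINT x:U|lborel. u x * laplacian \<eta> x) \<le> 0"
      using super bump_nonneg unfolding laplacian_nonpos_distr_def \<eta>_def by blast
    also have "(LINT x:U|lborel. u x * laplacian \<eta> x) = (\<integral>z. fu z * laplacian \<eta> z \<partial>lborel)"
      unfolding set_lebesgue_integral_def
    proof (intro Bochner_Integration.integral_cong refl)
      fix z
      have "laplacian \<eta> z = 0" if "z \<notin> K"
      proof (rule laplacian_eq_0_outside_support[OF _ _ that])
        show "\<eta> z = 0" if "z \<notin> K" for z
        proof -
          have "z \<notin> cball y2 \<tau>" using that sub by blast
          then show ?thesis using \<tau> by (simp add: \<eta>_def bump_eq_0_iff dist_commute)
        qed
      qed (simp add: K_def)
      then show "indicator U z *\<^sub>R (u z * laplacian \<eta> z) = fu z * laplacian \<eta> z"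
        using s(2) by (cases "z \<in> K") (auto simp: fu_def K_def)
    qed
    finally show ?thesis .
  qed
  have "0 \<le> (\<Sum>i\<in>Basis. \<integral>z. f z * \<eta>'' i z \<partial>lborel)"
    by (intro sum_nonneg f_pos)
  also have "\<dots> = (\<Sum>i\<in>Basis. (\<integral>z. fu z * \<eta>'' i z \<partial>lborel) - (\<integral>z. fS z * \<eta>'' i z \<partial>lborel))"
    by (intro sum.cong refl) (simp add: f_def left_diff_distrib int2 fu fS)
  also have "\<dots> = (\<Sum>i\<in>Basis. \<integral>z. fu z * \<eta>'' i z \<partial>lborel) - J * (\<Sum>i\<in>Basis. b i)"
    by (simp add: sum_subtractf fS_val sum_distrib_left)
  also have "(\<Sum>i\<in>Basis. \<integral>z. fu z * \<eta>'' i z \<partial>lborel) = (\<integral>z. (\<Sum>i\<in>Basis. fu z * \<eta>'' i z) \<partial>lborel)"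
    by (rule Bochner_Integration.integral_sum[symmetric]) (rule int2[OF fu])
  also have "\<dots> = (\<integral>z. fu z * laplacian \<eta> z \<partial>lborel)"
    by (simp add: lap sum_distrib_left)
  also have "(\<integral>z. fu z * laplacian \<eta> z \<partial>lborel) - J * (\<Sum>i\<in>Basis. b i) < 0"
    using fu_neg mult_pos_pos[OF J(1) b_sum] by linarith
  finally show False by simp
qed

section \<open>Comparison across an isolated point\<close>

text \<open>
  The coefficient \<open>1 / 2\<close> is the Taylor coefficient; any \<open>k > 0\<close> absorbs the remainder.
\<close>

lemma ln_quadratic_lower_bound:
  fixes k :: real
  assumes "k > 0"
  shows "\<forall>\<^sub>F t in nhds 0. t - (1 / 2 + k) * t\<^sup>2 \<le> ln (1 + t)"
proof -
  define F where "F t = ln (1 + t) - t + (1 / 2 + k) * t\<^sup>2" for t :: real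
  define \<delta> where "\<delta> = k / (1 + 2 * k)"
  have \<delta>: "\<delta> > 0" "\<delta> < 1" using assms by (auto simp: \<delta>_def field_simps)
  have deriv: "(F has_real_derivative (t * (2 * k + (1 + 2 * k) * t) / (1 + t))) (at t)" if "\<bar>t\<bar> \<le> \<delta>" for t
  proof -
    have t: "1 + t > 0" using that \<delta> by auto
    have "(F has_real_derivative (1 / (1 + t) - 1 + (1 / 2 + k) * (2 * t))) (at t)"
      unfolding F_def[abs_def] using t by (auto intro!: derivative_eq_intros)
    also have "1 / (1 + t) - 1 + (1 / 2 + k) * (2 * t) = t * (2 * k + (1 + 2 * k) * t) / (1 + t)"
      using t by (simp add: field_simps) 
    finally show ?thesis .
  qed
  have fac: "2 * k + (1 + 2 * k) * t \<ge> 0" if "\<bar>t\<bar> \<le> \<delta>" for t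
  proof -
    have "(1 + 2 * k) * \<bar>t\<bar> \<le> (1 + 2 * k) * \<delta>"
      using that assms by (intro mult_left_mono) auto
    also have "\<dots> \<le> 2 * k" using assms by (simp add: \<delta>_def field_simps)
    finally show ?thesis
      using assms by (cases "t \<ge> 0") auto
  qed
  have F_min: "F 0 \<le> F t" if "\<bar>t\<bar> \<le> \<delta>" for t
  proof (cases "t \<ge> 0")
    case True
    show ?thesis
    proof (rule DERIV_nonneg_imp_nondecreasing[OF True])
      fix x assume "0 \<le> x" "x \<le> t"
      then have "\<bar>x\<bar> \<le> \<delta>" using that by auto
      then show "\<exists>y. (F has_real_derivative y) (at x) \<and> 0 \<le> y"
        using deriv[of x] divide_nonneg_nonneg[OF mult_nonneg_nonneg[OF \<open>0 \<le> x\<close> fac[of x]], of "1 + x"]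
          \<open>0 \<le> x\<close> by auto
    qed
  next
    case False
    show ?thesis
    proof (rule DERIV_nonpos_imp_nonincreasing[of t 0])
      fix x assume "t \<le> x" "x \<le> 0"
      then have "\<bar>x\<bar> \<le> \<delta>" using that by auto
      then show "\<exists>y. (F has_real_derivative y) (at x) \<and> y \<le> 0"
        using deriv[of x] divide_nonpos_nonneg[OF mult_nonpos_nonneg[OF \<open>x \<le> 0\<close> fac[of x]], of "1 + x"]
          \<delta> by auto
    qed (use False in auto)
  qed
  have "t - (1 / 2 + k) * t\<^sup>2 \<le> ln (1 + t)" if "\<bar>t\<bar> \<le> \<delta>" for t
    using F_min[OF that] by (simp add: F_def)
  then show ?thesis
    unfolding eventually_nhds_metric using \<delta> by (intro exI[of _ \<delta>]) auto
qed

text \<open>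
  The second-order Taylor polynomial of \<open>ln (norm y)\<close> at \<open>c\<close>, lowered by \<open>k * (norm (y - c))\<^sup>2\<close>. It makes
  the logarithm, which is not quadratic, accessible to the touching lemma. Without the last term the
  Laplacian is \<open>(DIM('a) - 2) / (norm c)\<^sup>2\<close>, which is nonnegative in dimension at least \<open>2\<close>.
\<close>

lemma ln_norm_quadratic_minorant:
  fixes c :: "'a::euclidean_space"
  assumes "c \<noteq> 0" "k > 0"
  shows "\<forall>\<^sub>F y in nhds c. ln (norm c) + (c \<bullet> (y - c)) / (norm c)\<^sup>2
      + ((norm (y - c))\<^sup>2 / (norm c)\<^sup>2) / 2 - (c \<bullet> (y - c))\<^sup>2 / (norm c) ^ 4 - k * (norm (y - c))\<^sup>2
      \<le> ln (norm y)"
proof -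
  define s where "s = (norm c)\<^sup>2"
  have s: "s > 0" using assms by (simp add: s_def)
  \<comment> \<open>\<open>t\<close> is chosen so that \<open>(norm y)\<^sup>2 = s * (1 + t y)\<close>.\<close>
  define t where "t y = (2 * (c \<bullet> (y - c)) + (norm (y - c))\<^sup>2) / s" for y
  define B where "B = (2 * norm c + 1)\<^sup>2 / s\<^sup>2"
  have N: "2 * norm c + 1 > 0" using norm_ge_zero[of c] by linarith
  have B: "B > 0" unfolding B_def using s N by (intro divide_pos_pos zero_less_power)
  define k' where "k' = k / B"
  have k': "k' > 0" using assms B by (simp add: k'_def)
  have t0: "(t \<longlongrightarrow> 0) (nhds c)"
    using s unfolding t_def by (auto intro!: tendsto_eq_intros filterlim_ident)
  have "\<forall>\<^sub>F y in nhds c. t y - (1 / 2 + k') * (t y)\<^sup>2 \<le> ln (1 + t y)"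
    using eventually_compose_filterlim[OF ln_quadratic_lower_bound[OF k'] t0] .
  moreover have "\<forall>\<^sub>F y in nhds c. - 1 < t y"
    using t0 by (rule order_tendstoD) simp
  moreover have "\<forall>\<^sub>F y in nhds c. norm (y - c) < min 1 (k * s\<^sup>2 / (2 * norm c + 1))"
  proof -
    have "min 1 (k * s\<^sup>2 / (2 * norm c + 1)) > 0" using assms s N by simp
    then show ?thesis unfolding eventually_nhds_metric dist_norm by blast
  qed
  ultimately show ?thesis
  proof eventually_elim
    case (elim y)
    define A where "A = c \<bullet> (y - c)"
    define n where "n = norm (y - c)"
    have n: "0 \<le> n" "n \<le> 1" "n * (2 * norm c + 1) \<le> k * s\<^sup>2"
      using elim(3) N by (auto simp: n_def field_simps)
    have A: "\<bar>A\<bar> \<le> norm c * n"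
      unfolding A_def n_def by (rule Cauchy_Schwarz_ineq2)
    have ty: "t y = (2 * A + n\<^sup>2) / s" by (simp add: t_def A_def n_def)
    have "(norm y)\<^sup>2 = s * (1 + t y)"
    proof -
      have "(norm y)\<^sup>2 = s + 2 * A + n\<^sup>2"
        unfolding s_def n_def A_def power2_norm_eq_inner
        by (simp add: inner_diff_left inner_diff_right inner_commute)
      then show ?thesis using s by (simp add: ty field_simps)
    qed
    then have "ln ((norm y)\<^sup>2) = ln s + ln (1 + t y)"
      using s elim(2) by (simp add: ln_mult)
    moreover have "ln ((norm y)\<^sup>2) = 2 * ln (norm y)"
    proof -
      have "s * (1 + t y) > 0" using s elim(2) by simp
      then have "norm y > 0" using \<open>(norm y)\<^sup>2 = s * (1 + t y)\<close> by (auto simp: zero_less_power2)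
      then show ?thesis by (simp add: ln_realpow)
    qed
    moreover have "ln s = 2 * ln (norm c)"
      using assms by (simp add: s_def ln_realpow)
    ultimately have "2 * ln (norm y) \<ge> 2 * ln (norm c) + t y - (1 / 2 + k') * (t y)\<^sup>2"
      using elim(1) by linarith
    then have lower: "ln (norm y) \<ge> ln (norm c) + t y / 2 - (t y)\<^sup>2 / 4 - k' / 2 * (t y)\<^sup>2"
      by (simp add: algebra_simps)
    have n2: "n\<^sup>2 \<le> n" using n by (simp add: power2_eq_square mult_left_le)
    have "\<bar>2 * A + n\<^sup>2\<bar> \<le> (2 * norm c + 1) * n"
      using A n2 n by (simp add: algebra_simps abs_le_iff, use zero_le_power2[of n] in linarith)
    then have "(2 * A + n\<^sup>2)\<^sup>2 \<le> ((2 * norm c + 1) * n)\<^sup>2"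
      by (rule power2_le_iff_abs_le[THEN iffD2, rotated]) (use n N in auto)
    then have "(t y)\<^sup>2 \<le> B * n\<^sup>2"
      using s by (simp add: ty B_def power_divide power_mult_distrib divide_right_mono)
    then have e1: "k' / 2 * (t y)\<^sup>2 \<le> k / 2 * n\<^sup>2"
      using mult_left_mono[of "(t y)\<^sup>2" "B * n\<^sup>2" "k' / 2"] k' B by (simp add: k'_def)
    have "4 * A + n\<^sup>2 \<le> 2 * ((2 * norm c + 1) * n)"
      using A n2 n by (simp add: algebra_simps abs_le_iff)
    also have "\<dots> \<le> 2 * (k * s\<^sup>2)" using n(3) by (simp add: mult.commute)
    finally have "(4 * A + n\<^sup>2) * n\<^sup>2 \<le> (2 * (k * s\<^sup>2)) * n\<^sup>2"
      by (intro mult_right_mono) auto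
    then have "(4 * A + n\<^sup>2) * n\<^sup>2 / (4 * s\<^sup>2) \<le> (2 * (k * s\<^sup>2)) * n\<^sup>2 / (4 * s\<^sup>2)"
      using s by (intro divide_right_mono) auto
    then have e2: "(4 * A + n\<^sup>2) * n\<^sup>2 / (4 * s\<^sup>2) \<le> k / 2 * n\<^sup>2"
      using s by simp
    have "(t y)\<^sup>2 / 4 = A\<^sup>2 / s\<^sup>2 + (4 * A + n\<^sup>2) * n\<^sup>2 / (4 * s\<^sup>2)"
      using s by (simp add: ty field_simps power2_eq_square)
    with lower e1 e2 have "ln (norm c) + t y / 2 - A\<^sup>2 / s\<^sup>2 - k * n\<^sup>2 \<le> ln (norm y)"
      by linarith
    moreover have "t y / 2 = A / s + (n\<^sup>2 / s) / 2" by (simp add: ty add_divide_distrib)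
    moreover have "s\<^sup>2 = norm c ^ 4" by (simp add: s_def)
    ultimately show ?case by (simp add: A_def n_def s_def)
  qed
qed

text \<open>
  The minimum principle on a punctured ball. The term \<open>\<epsilon> * ln (norm y / r)\<close> vanishes on the sphere and tends to
  \<open>-\<infinity>\<close> at the origin, so the corrected difference \<open>w\<close> is nonnegative close to the origin whatever \<open>u\<close> does
  there. A negative minimum of \<open>w\<close> would hence be attained inside an annulus, where \<open>u\<close> would be touched from
  below by a function with positive Laplacian; the term with \<open>\<kappa>\<close> makes that Laplacian strictly positive.
\<close>

lemma distr_superharmonic_ge_across_isolated_point:
  fixes u P :: "'a::euclidean_space \<Rightarrow> real"
  assumes dim: "DIM('a) \<ge> 2" and "r > 0" and "open U" and U: "cball 0 r - {0} \<subseteq> U" "0 \<notin> U"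
    and u: "continuous_on U u" and super: "laplacian_nonpos_distr U u"
    and bdd: "\<And>y. y \<in> cball 0 r - {0} \<Longrightarrow> m \<le> u y"
    and P: "pure_second_derivs P b" and P_sub: "(\<Sum>i\<in>(Basis::'a set). b i) \<ge> 0"
    and bdry: "\<And>y. norm y = r \<Longrightarrow> P y \<le> u y"
    and y0: "y0 \<in> cball 0 r - {0}"
  shows "P y0 \<le> u y0"
proof (rule ccontr)
  assume "\<not> P y0 \<le> u y0"
  then have gap: "P y0 - u y0 > 0" (is "?g > 0") by simp
  have P_cont: "continuous_on A P" for A
    using P continuous_on_subset by (auto simp: pure_second_derivs_def)
  \<comment> \<open>Each of the two corrections costs at most a quarter of the gap at \<open>y0\<close>, so \<open>w y0\<close> stays negative.\<close>
  define \<kappa> where "\<kappa> = ?g / (4 * r\<^sup>2)"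
  have \<kappa>: "\<kappa> > 0" using gap \<open>r > 0\<close> by (simp add: \<kappa>_def)
  define \<epsilon> where "\<epsilon> = ?g / (4 * (1 + \<bar>ln (norm y0 / r)\<bar>))"
  have \<epsilon>: "\<epsilon> > 0" using gap by (simp add: \<epsilon>_def add_pos_nonneg)
  define w where "w y = u y - P y - \<kappa> * ((norm y)\<^sup>2 - r\<^sup>2) - \<epsilon> * ln (norm y / r)" for y
  have w_y0: "w y0 < 0"
  proof -
    let ?l = "\<bar>ln (norm y0 / r)\<bar>"
    have "1 + ?l > 0" by (simp add: add_pos_nonneg)
    then have "\<epsilon> * (1 + ?l) = ?g / 4"
      unfolding \<epsilon>_def by (metis less_numeral_extra(3) mult.commute
          nonzero_mult_divide_mult_cancel_left times_divide_eq_left)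
    then have "\<epsilon> * ?l \<le> ?g / 4" using \<epsilon> by (simp add: algebra_simps)
    moreover have "- (\<epsilon> * ln (norm y0 / r)) \<le> \<epsilon> * ?l"
      using \<epsilon> mult_left_mono[of "- ln (norm y0 / r)" ?l \<epsilon>] by simp
    ultimately have "- (\<epsilon> * ln (norm y0 / r)) \<le> ?g / 4"
      by (rule order_trans[rotated])
    moreover have "\<kappa> * r\<^sup>2 = ?g / 4" using \<open>r > 0\<close> by (simp add: \<kappa>_def)
    moreover have "0 \<le> \<kappa> * (norm y0)\<^sup>2" using \<kappa> by simp
    moreover have "U - V - (c - b) - a < 0"
      if "- a \<le> (V - U) / 4" "b = (V - U) / 4" "0 \<le> c" "0 < V - U" for a b c U V :: real
      using that by argo
    ultimately show ?thesis
      unfolding w_def right_diff_distrib using gap by blast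
  qed
  have "cball (0::'a) r \<noteq> {}" using \<open>r > 0\<close> by simp
  then obtain yM where "\<forall>y\<in>cball 0 r. P y \<le> P yM"
    using continuous_attains_sup[OF compact_cball _ P_cont] by blast
  then obtain M where M: "\<And>y. y \<in> cball 0 r \<Longrightarrow> P y \<le> M"
    by blast
  define \<delta> where "\<delta> = r * exp (- (\<bar>M - m\<bar> / \<epsilon>))"
  have \<delta>: "\<delta> > 0" "\<delta> \<le> r" using \<open>r > 0\<close> \<epsilon> by (auto simp: \<delta>_def mult_left_le)
  have w_inner: "w y \<ge> 0" if y: "y \<noteq> 0" "norm y \<le> \<delta>" for y
  proof -
    have "norm y / r \<le> exp (- (\<bar>M - m\<bar> / \<epsilon>))"
      using y \<open>r > 0\<close> by (simp add: \<delta>_def field_simps)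
    then have "ln (norm y / r) \<le> - (\<bar>M - m\<bar> / \<epsilon>)"
      using y \<open>r > 0\<close> by (metis divide_pos_pos ln_exp ln_le_cancel_iff exp_gt_zero zero_less_norm_iff)
    then have "\<epsilon> * ln (norm y / r) \<le> - \<bar>M - m\<bar>"
      using \<epsilon> mult_left_mono[of "ln (norm y / r)" "- (\<bar>M - m\<bar> / \<epsilon>)" \<epsilon>] by simp
    moreover have "\<kappa> * ((norm y)\<^sup>2 - r\<^sup>2) \<le> 0"
      using \<kappa> y \<delta> by (intro mult_nonneg_nonpos) (auto intro!: power_mono)
    moreover have "P y \<le> M" "m \<le> u y" using M bdd y \<delta> by auto
    ultimately show ?thesis unfolding w_def by linarith
  qed
  define A where "A = {y::'a. \<delta> \<le> norm y} \<inter> cball 0 r"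
  have A_U: "A \<subseteq> U" using U(1) \<delta> by (auto simp: A_def)
  have A_cont: "continuous_on A w"
    unfolding w_def using \<delta> \<open>r > 0\<close>
    by (intro continuous_intros continuous_on_subset[OF u A_U] P_cont) (auto simp: A_def)
  have "closed {y::'a. \<delta> \<le> norm y}"
    by (intro closed_Collect_le continuous_intros)
  then have "compact A"
    unfolding A_def by (intro closed_Int_compact) auto
  moreover have "y0 \<in> A" using y0 w_y0 w_inner[of y0] by (force simp: A_def)
  ultimately obtain y1 where y1: "y1 \<in> A" "\<And>y. y \<in> A \<Longrightarrow> w y1 \<le> w y"
    using continuous_attains_inf[of A w] A_cont by blast
  have w_y1: "w y1 < 0" using y1(2)[OF \<open>y0 \<in> A\<close>] w_y0 by linarith
  have "norm y1 \<noteq> r" using w_y1 bdry[of y1] \<open>r > 0\<close> by (auto simp: w_def)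
  then have y1_in: "\<delta> < norm y1" "norm y1 < r"
    using w_y1 y1(1) w_inner[of y1] \<delta> by (force simp: A_def)+
  have "y1 \<noteq> 0" using y1_in \<delta> by auto
  define s where "s = (norm y1)\<^sup>2"
  have s: "s > 0" using \<open>y1 \<noteq> 0\<close> by (simp add: s_def)
  define k where "k = \<kappa> / (2 * \<epsilon>)"
  have k: "k > 0" using \<kappa> \<epsilon> by (simp add: k_def)
  \<comment> \<open>Near \<open>y1\<close>, \<open>L / s\<close> is the quadratic minorant of \<open>ln (norm y) - ln (norm y1)\<close>; its coefficient \<open>k\<close> uses up half of what \<open>\<kappa>\<close> contributes to the Laplacian.\<close>
  define L where "L y = y1 \<bullet> (y - y1) + (1 / 2) * (norm (y - y1))\<^sup>2
      + (- (1 / s)) * (y1 \<bullet> (y - y1))\<^sup>2 + (- (s * k)) * (norm (y - y1))\<^sup>2" for y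
  define l where "l i = 0 + (1 / 2) * 2 + (- (1 / s)) * (2 * (y1 \<bullet> i)\<^sup>2) + (- (s * k)) * 2" for i :: 'a
  define T where "T y = P y + \<kappa> * (norm (y - 0))\<^sup>2 + (\<epsilon> / s) * L y" for y
  define a where "a i = b i + \<kappa> * 2 + (\<epsilon> / s) * l i" for i
  have T: "pure_second_derivs T a"
    unfolding T_def[abs_def] a_def[abs_def] L_def l_def
    by (intro pure_second_derivs_add P pure_second_derivs_cmult pure_second_derivs_inner
        pure_second_derivs_inner_square pure_second_derivs_norm_square)
  define N where "N = real DIM('a)"
  have "(\<Sum>i\<in>Basis. (y1 \<bullet> i)\<^sup>2) = s"
    unfolding s_def power2_norm_eq_inner by (subst euclidean_inner) (simp add: power2_eq_square)
  then have "(\<Sum>i\<in>Basis. l i) = N - 2 - 2 * N * (s * k)"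
    using s by (simp add: l_def sum.distrib sum_subtractf N_def sum_divide_distrib[symmetric]
        sum_distrib_left[symmetric])
  then have "(\<epsilon> / s) * (\<Sum>i\<in>Basis. l i) = (\<epsilon> / s) * (N - 2) - N * \<kappa>"
    using s \<epsilon> by (simp add: k_def field_simps)
  moreover have "(\<Sum>i\<in>Basis. a i) = (\<Sum>i\<in>(Basis::'a set). b i) + 2 * N * \<kappa> + (\<epsilon> / s) * (\<Sum>i\<in>Basis. l i)"
    by (simp add: a_def sum.distrib N_def sum_distrib_left)
  moreover have "(\<epsilon> / s) * (N - 2) \<ge> 0" "N * \<kappa> > 0"
    using s \<epsilon> dim \<kappa> by (auto simp: N_def)
  ultimately have a_pos: "(\<Sum>i\<in>Basis. a i) > 0" using P_sub by linarith
  have "\<forall>\<^sub>F y in nhds y1. y \<in> {y. \<delta> < norm y} \<inter> ball 0 r"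
    by (intro eventually_nhds_in_open open_Int open_Collect_less continuous_intros)
      (use y1_in in auto)
  with ln_norm_quadratic_minorant[OF \<open>y1 \<noteq> 0\<close> k]
  have "\<forall>\<^sub>F y in nhds y1. u y1 - T y1 \<le> u y - T y"
  proof eventually_elim
    case (elim y)
    have "L y / s = (y1 \<bullet> (y - y1)) / s + ((norm (y - y1))\<^sup>2 / s) / 2
        - (y1 \<bullet> (y - y1))\<^sup>2 / s\<^sup>2 - k * (norm (y - y1))\<^sup>2"
      using s by (simp add: L_def field_simps power2_eq_square)
    moreover have "s\<^sup>2 = norm y1 ^ 4" by (simp add: s_def)
    ultimately have "ln (norm y1) + L y / s \<le> ln (norm y)"
      using elim(1) by (simp add: s_def)
    then have "\<epsilon> * (ln (norm y1) + L y / s) \<le> \<epsilon> * ln (norm y)"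
      using \<epsilon> by (intro mult_left_mono) auto
    then have ln: "\<epsilon> * ln (norm y1) + (\<epsilon> / s) * L y \<le> \<epsilon> * ln (norm y)"
      by (simp add: distrib_left)
    have w_eq: "u y - T y = w y - \<kappa> * r\<^sup>2 + \<epsilon> * ln (norm y) - \<epsilon> * ln r - (\<epsilon> / s) * L y"
      if "y \<noteq> 0" for y
      using that \<open>r > 0\<close> by (simp add: w_def T_def ln_div right_diff_distrib)
    have "L y1 = 0" by (simp add: L_def)
    moreover have "y \<noteq> 0" "w y1 \<le> w y" using elim(2) \<delta> y1(2)[of y] by (auto simp: A_def)
    ultimately show ?case
      using w_eq[of y] w_eq[OF \<open>y1 \<noteq> 0\<close>] ln by simp
  qed
  then obtain d where "d > 0" "\<And>y. dist y y1 < d \<Longrightarrow> u y1 - T y1 \<le> u y - T y"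
    unfolding eventually_nhds_metric by blast
  then show False
    using distr_superharmonic_no_subharmonic_minorant_touching[OF \<open>open U\<close> u super _ T a_pos]
      y1(1) A_U by blast
qed

section \<open>Contact at an isolated point\<close>

lemma distr_superharmonic_minorant_le_cluster_value:
  fixes u P :: "'a::euclidean_space \<Rightarrow> real"
  assumes dim: "DIM('a) \<ge> 2" and "r > 0" and "open U" and U: "cball 0 r - {0} \<subseteq> U" "0 \<notin> U"
    and u: "continuous_on U u" and super: "laplacian_nonpos_distr U u"
    and bdd: "\<And>y. y \<in> cball 0 r - {0} \<Longrightarrow> m \<le> u y"
    and P: "pure_second_derivs P b" and P_sub: "(\<Sum>i\<in>(Basis::'a set). b i) \<ge> 0"
    and bdry: "\<And>y. norm y = r \<Longrightarrow> P y \<le> u y"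
    and cluster: "\<And>e. e > 0 \<Longrightarrow> \<exists>\<^sub>F y in at 0. u y < \<alpha> + e"
  shows "P 0 \<le> \<alpha>"
proof (rule ccontr)
  assume "\<not> P 0 \<le> \<alpha>"
  define e where "e = (P 0 - \<alpha>) / 2"
  have e: "e > 0" using \<open>\<not> P 0 \<le> \<alpha>\<close> by (simp add: e_def)
  have "isCont P 0" using P by (simp add: pure_second_derivs_def continuous_on_eq_continuous_at)
  then have "\<forall>\<^sub>F y in at 0. \<alpha> + e < P y"
    unfolding isCont_def by (rule order_tendstoD) (use e in \<open>simp add: e_def field_simps\<close>)
  moreover have "\<forall>\<^sub>F y in at 0. y \<in> cball (0::'a) r - {0}"
    using \<open>r > 0\<close> unfolding eventually_at by (intro exI[of _ r]) auto
  ultimately have "\<forall>\<^sub>F y in at 0. \<not> u y < \<alpha> + e"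
  proof eventually_elim
    case (elim y)
    then show ?case
      using distr_superharmonic_ge_across_isolated_point[OF dim \<open>r > 0\<close> \<open>open U\<close> U u super bdd P P_sub bdry, of y]
      by auto
  qed
  then show False using cluster[OF e] by (simp add: frequently_def)
qed

text \<open>
  If the gradients differ, then up to \<open>o(norm y)\<close> the function \<open>u\<close> is at least
  \<open>\<alpha> + p \<bullet> y + \<bar>q \<bullet> y\<bar>\<close> with \<open>p\<close> the mean and \<open>q\<close> half the difference of the gradients. On the
  sphere of radius \<open>r\<close> the modulus dominates \<open>(q \<bullet> y)\<^sup>2 / (norm q * r)\<close>. The harmonic quadratic polynomial
  with these boundary values equals \<open>norm q * r / DIM('a)\<close> at the origin, which beats the error
  \<open>\<epsilon> * r\<close>. By comparison \<open>u\<close> would stay above \<open>\<alpha>\<close> near the origin.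
\<close>

lemma distr_superharmonic_touching_gradients_eq:
  fixes u f\<^sub>1 f\<^sub>2 :: "'a::euclidean_space \<Rightarrow> real"
  assumes dim: "DIM('a) \<ge> 2" and "open U" and U: "\<forall>\<^sub>F y in at 0. y \<in> U" "0 \<notin> U"
    and u: "continuous_on U u" and super: "laplacian_nonpos_distr U u"
    and cluster: "\<And>e. e > 0 \<Longrightarrow> \<exists>\<^sub>F y in at 0. u y < \<alpha> + e"
    and f\<^sub>1: "(f\<^sub>1 has_derivative (\<lambda>h. p\<^sub>1 \<bullet> h)) (at 0)" "f\<^sub>1 0 = \<alpha>" "\<forall>\<^sub>F y in at 0. f\<^sub>1 y \<le> u y"
    and f\<^sub>2: "(f\<^sub>2 has_derivative (\<lambda>h. p\<^sub>2 \<bullet> h)) (at 0)" "f\<^sub>2 0 = \<alpha>" "\<forall>\<^sub>F y in at 0. f\<^sub>2 y \<le> u y"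
  shows "p\<^sub>1 = p\<^sub>2"
proof (rule ccontr)
  assume "p\<^sub>1 \<noteq> p\<^sub>2"
  define q where "q = (1 / 2) *\<^sub>R (p\<^sub>1 - p\<^sub>2)"
  define p where "p = (1 / 2) *\<^sub>R (p\<^sub>1 + p\<^sub>2)"
  have pq: "p\<^sub>1 = p + q" "p\<^sub>2 = p - q"
    by (simp_all add: p_def q_def algebra_simps flip: scaleR_add_left)
  have q: "norm q > 0" using \<open>p\<^sub>1 \<noteq> p\<^sub>2\<close> by (simp add: q_def)
  define N where "N = real DIM('a)"
  have N: "N > 0" by (simp add: N_def)
  \<comment> \<open>Half of the value \<open>norm q / N\<close> that the harmonic polynomial gains at the origin, per unit of \<open>r\<close>.\<close>
  define \<epsilon> where "\<epsilon> = norm q / (2 * N)"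
  have \<epsilon>: "\<epsilon> > 0" using q N by (simp add: \<epsilon>_def)
  have expand: "\<forall>\<^sub>F y in at 0. \<alpha> + p' \<bullet> y - \<epsilon> * norm y \<le> u y"
    if f: "(f has_derivative (\<lambda>h. p' \<bullet> h)) (at 0)" "f 0 = \<alpha>" "\<forall>\<^sub>F y in at 0. f y \<le> u y" for f p'
  proof -
    obtain d where d: "d > 0" "\<And>y. norm y < d \<Longrightarrow> \<bar>f y - \<alpha> - p' \<bullet> y\<bar> \<le> \<epsilon> * norm y"
      using f(1,2) \<epsilon> unfolding has_derivative_at_alt by force
    have "\<forall>\<^sub>F y in at 0. norm y < d"
      using d(1) unfolding eventually_at by (intro exI[of _ d]) auto
    with f(3) show ?thesis
    proof eventually_elim
      case (elim y)
      then show ?case using d(2)[of y] by (auto simp: abs_le_iff)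
    qed
  qed
  have "\<forall>\<^sub>F y in at 0. y \<in> U \<and> \<alpha> + p\<^sub>1 \<bullet> y - \<epsilon> * norm y \<le> u y \<and> \<alpha> + p\<^sub>2 \<bullet> y - \<epsilon> * norm y \<le> u y"
    using U(1) expand[OF f\<^sub>1] expand[OF f\<^sub>2] by eventually_elim auto
  then obtain d where d: "d > 0" "\<And>y. y \<noteq> 0 \<Longrightarrow> norm y < d \<Longrightarrow> y \<in> U"
    "\<And>y. y \<noteq> 0 \<Longrightarrow> norm y < d \<Longrightarrow> \<alpha> + p\<^sub>1 \<bullet> y - \<epsilon> * norm y \<le> u y"
    "\<And>y. y \<noteq> 0 \<Longrightarrow> norm y < d \<Longrightarrow> \<alpha> + p\<^sub>2 \<bullet> y - \<epsilon> * norm y \<le> u y"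
    unfolding eventually_at by auto
  define r where "r = d / 2"
  have r: "r > 0" "r < d" using d by (auto simp: r_def)
  have U': "cball 0 r - {0} \<subseteq> U"
  proof
    fix y :: 'a assume "y \<in> cball 0 r - {0}"
    then show "y \<in> U" using d(2)[of y] r by auto
  qed
  define P where "P y = (\<alpha> - \<epsilon> * r + norm q * r / N) + p \<bullet> (y - 0)
      + (1 / (norm q * r)) * (q \<bullet> (y - 0))\<^sup>2 + (- (norm q / (N * r))) * (norm (y - 0))\<^sup>2" for y
  define b where "b i = 0 + 0 + (1 / (norm q * r)) * (2 * (q \<bullet> i)\<^sup>2) + (- (norm q / (N * r))) * 2" for i
  have P: "pure_second_derivs P b"
    unfolding P_def[abs_def] b_def[abs_def]
    by (intro pure_second_derivs_add pure_second_derivs_cmult pure_second_derivs_inner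
        pure_second_derivs_inner_square pure_second_derivs_norm_square pure_second_derivs_const)
  have qi: "(\<Sum>i\<in>Basis. (q \<bullet> i)\<^sup>2) = (norm q)\<^sup>2"
    unfolding power2_norm_eq_inner by (subst euclidean_inner) (simp add: power2_eq_square)
  have "(\<Sum>i\<in>Basis. b i) = (1 / (norm q * r)) * (2 * (\<Sum>i\<in>Basis. (q \<bullet> i)\<^sup>2)) - N * ((norm q / (N * r)) * 2)"
    unfolding sum_distrib_left by (simp add: b_def sum.distrib sum_subtractf N_def)
  also have "\<dots> = 0" unfolding qi using q r N by (simp add: power2_eq_square)
  finally have b: "(\<Sum>i\<in>Basis. b i) \<ge> 0" by simp
  have bdry: "P y \<le> u y" if "norm y = r" for y
  proof -
    have qy: "\<bar>q \<bullet> y\<bar> \<le> norm q * r" using Cauchy_Schwarz_ineq2[of q y] that by simp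
    have "(q \<bullet> y)\<^sup>2 = \<bar>q \<bullet> y\<bar> * \<bar>q \<bullet> y\<bar>" by (simp add: power2_eq_square)
    also have "\<dots> \<le> (norm q * r) * \<bar>q \<bullet> y\<bar>" using qy by (intro mult_right_mono) auto
    finally have "(1 / (norm q * r)) * (q \<bullet> y)\<^sup>2 \<le> \<bar>q \<bullet> y\<bar>"
      using q r by (simp add: field_simps)
    moreover have "(norm q / (N * r)) * r\<^sup>2 = norm q * r / N" using r by (simp add: power2_eq_square)
    ultimately have "P y \<le> \<alpha> - \<epsilon> * r + p \<bullet> y + \<bar>q \<bullet> y\<bar>"
      unfolding P_def using that by simp
    moreover have "\<alpha> + p \<bullet> y + q \<bullet> y - \<epsilon> * r \<le> u y" "\<alpha> + p \<bullet> y - q \<bullet> y - \<epsilon> * r \<le> u y"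
      using d(3,4)[of y] that r by (auto simp: pq inner_add_left inner_diff_left add.assoc algebra_simps)
    ultimately show ?thesis by (auto simp: abs_if split: if_splits)
  qed
  have bdd: "\<alpha> - norm p\<^sub>1 * r - \<epsilon> * r \<le> u y" if "y \<in> cball 0 r - {0}" for y
  proof -
    have y: "norm y \<le> r" using that by simp
    have "\<bar>p\<^sub>1 \<bullet> y\<bar> \<le> norm p\<^sub>1 * r"
      using Cauchy_Schwarz_ineq2[of p\<^sub>1 y] mult_left_mono[OF y, of "norm p\<^sub>1"] by simp
    moreover have "\<epsilon> * norm y \<le> \<epsilon> * r" using y \<epsilon> by simp
    ultimately show ?thesis using d(3)[of y] that r by (auto simp: abs_le_iff)
  qed
  have "P 0 \<le> \<alpha>"
    by (rule distr_superharmonic_minorant_le_cluster_value[OF dim r(1) \<open>open U\<close> U' U(2) u super bdd P b bdry cluster])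
  moreover have "P 0 = \<alpha> + norm q * r / (2 * N)"
    using N by (simp add: P_def \<epsilon>_def field_simps)
  moreover have "norm q * r / (2 * N) > 0" using q r N by simp
  ultimately show False by linarith
qed

text \<open>
  The strong minimum principle at the isolated point: a positive gap to the affine function on a small sphere persists
  inside it, by comparison with the affine function raised by the gap.
\<close>

lemma distr_superharmonic_not_above_affine_touching:
  fixes u :: "'a::euclidean_space \<Rightarrow> real"
  assumes dim: "DIM('a) \<ge> 2" and "open U" and U: "\<forall>\<^sub>F y in at 0. y \<in> U" "0 \<notin> U"
    and u: "continuous_on U u" and super: "laplacian_nonpos_distr U u"
    and cluster: "\<And>e. e > 0 \<Longrightarrow> \<exists>\<^sub>F y in at 0. u y < \<alpha> + e"
    and above: "\<forall>\<^sub>F y in at 0. \<alpha> + p \<bullet> y < u y"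
  shows False
proof -
  have "\<forall>\<^sub>F y in at 0. y \<in> U \<and> \<alpha> + p \<bullet> y < u y"
    using U(1) above by eventually_elim auto
  then obtain d where d: "d > 0" "\<And>y. y \<noteq> 0 \<Longrightarrow> norm y < d \<Longrightarrow> y \<in> U"
    "\<And>y. y \<noteq> 0 \<Longrightarrow> norm y < d \<Longrightarrow> \<alpha> + p \<bullet> y < u y"
    unfolding eventually_at by auto
  define r where "r = d / 2"
  have r: "r > 0" "r < d" using d by (auto simp: r_def)
  have U': "cball 0 r - {0} \<subseteq> U"
  proof
    fix y :: 'a assume "y \<in> cball 0 r - {0}"
    then show "y \<in> U" using d(2)[of y] r by auto
  qed
  obtain y' :: 'a where "norm y' = r" using vector_choose_size[of r] r by auto
  then have "sphere (0::'a) r \<noteq> {}" by auto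
  moreover have "sphere 0 r \<subseteq> U" using d(2) r by auto
  then have "continuous_on (sphere 0 r) (\<lambda>y. u y - \<alpha> - p \<bullet> y)"
    by (intro continuous_intros continuous_on_subset[OF u])
  ultimately obtain y1 where y1: "y1 \<in> sphere 0 r"
    "\<forall>y\<in>sphere 0 r. u y1 - \<alpha> - p \<bullet> y1 \<le> u y - \<alpha> - p \<bullet> y"
    using continuous_attains_inf[of "sphere 0 r"] compact_sphere by blast
  define m where "m = u y1 - \<alpha> - p \<bullet> y1"
  have m: "m > 0" using d(3)[of y1] y1(1) r by (auto simp: m_def)
  define P where "P y = (\<alpha> + m) + p \<bullet> (y - 0)" for y
  have P: "pure_second_derivs P (\<lambda>i. 0 + 0)"
    unfolding P_def[abs_def]
    by (intro pure_second_derivs_add pure_second_derivs_inner pure_second_derivs_const)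
  have bdd: "\<alpha> - norm p * r \<le> u y" if "y \<in> cball 0 r - {0}" for y
  proof -
    have y: "norm y \<le> r" using that by simp
    have "\<bar>p \<bullet> y\<bar> \<le> norm p * r"
      using Cauchy_Schwarz_ineq2[of p y] mult_left_mono[OF y, of "norm p"] by simp
    then show ?thesis using d(3)[of y] that r by (auto simp: abs_le_iff)
  qed
  have bdry: "P y \<le> u y" if "norm y = r" for y
    using bspec[OF y1(2), of y] that by (simp add: P_def m_def)
  have "P 0 \<le> \<alpha>"
    by (rule distr_superharmonic_minorant_le_cluster_value[OF dim r(1) \<open>open U\<close> U' U(2) u super bdd P _ bdry cluster])
      auto
  then show False using m by (simp add: P_def)
qed

section \<open>Functions with collinear gradients\<close>

text \<open>
  The mean value theorem is used twice on the segment from \<open>0\<close> to \<open>y\<close>: once to find that \<open>v\<close> varies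
  along the segment with the sign of \<open>p \<bullet> y\<close>, which decides whether \<open>c\<close> is at most or at least \<open>1\<close>, and once
  to convert this into \<open>p \<bullet> y \<le> (p \<bullet> y) / c\<close>, a bound on the increment of \<open>v\<close>.
\<close>

lemma ge_tangent_plane_if_gradients_collinear:
  fixes v :: "'a::real_inner \<Rightarrow> real"
  assumes deriv: "\<And>x. x \<in> ball 0 \<rho> \<Longrightarrow> (v has_derivative (\<lambda>h. g x \<bullet> h)) (at x)"
    and c: "\<And>x. x \<in> ball 0 \<rho> \<Longrightarrow> c x > 0" "\<And>x. x \<in> ball 0 \<rho> \<Longrightarrow> c x *\<^sub>R g x = p"
    and c_le: "\<And>x. x \<in> ball 0 \<rho> \<Longrightarrow> v 0 \<le> v x \<Longrightarrow> c x \<le> 1"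
    and c_ge: "\<And>x. x \<in> ball 0 \<rho> \<Longrightarrow> v x \<le> v 0 \<Longrightarrow> 1 \<le> c x"
    and y: "y \<in> ball 0 \<rho>"
  shows "v 0 + p \<bullet> y \<le> v y"
proof -
  have g: "g x \<bullet> h = (p \<bullet> h) / c x" if "x \<in> ball 0 \<rho>" for x h
    using c[OF that] by (simp add: inner_scaleR_left flip: c(2)[OF that])
  have mvt: "\<exists>t. 0 < t \<and> t < 1 \<and> t *\<^sub>R z \<in> ball 0 \<rho> \<and> v z - v 0 = (p \<bullet> z) / c (t *\<^sub>R z)"
    if z: "z \<in> ball 0 \<rho>" for z
  proof -
    have in_ball: "t *\<^sub>R z \<in> ball 0 \<rho>" if "0 \<le> t" "t \<le> 1" for t
      using z that mult_right_mono[of t 1 "norm z"] by auto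
    have "((\<lambda>t. v (t *\<^sub>R z)) has_real_derivative (p \<bullet> z) / c (t *\<^sub>R z)) (at t)"
      if "0 \<le> t" "t \<le> 1" for t
    proof -
      have "((\<lambda>t. t *\<^sub>R z) has_derivative (\<lambda>h. h *\<^sub>R z)) (at t)"
        by (auto intro!: derivative_eq_intros)
      from has_derivative_compose[OF this deriv[OF in_ball[OF that]]]
      have "((\<lambda>t. v (t *\<^sub>R z)) has_derivative (\<lambda>h. h * ((p \<bullet> z) / c (t *\<^sub>R z)))) (at t)"
        by (simp add: g[OF in_ball[OF that]])
      then show ?thesis
        by (simp only: has_field_derivative_def mult_commute_abs)
    qed
    then obtain t where "0 < t" "t < 1" "v (1 *\<^sub>R z) - v (0 *\<^sub>R z) = (1 - 0) * ((p \<bullet> z) / c (t *\<^sub>R z))"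
      using MVT2[of 0 1 "\<lambda>t. v (t *\<^sub>R z)" "\<lambda>t. (p \<bullet> z) / c (t *\<^sub>R z)"] by auto
    then show ?thesis using in_ball[of t] by auto
  qed
  obtain t where t: "0 < t" "t < 1" "t *\<^sub>R y \<in> ball 0 \<rho>" "v y - v 0 = (p \<bullet> y) / c (t *\<^sub>R y)"
    using mvt[OF y] by blast
  obtain t' where t': "0 < t'" "t' < 1" "t' *\<^sub>R (t *\<^sub>R y) \<in> ball 0 \<rho>"
    "v (t *\<^sub>R y) - v 0 = (p \<bullet> (t *\<^sub>R y)) / c (t' *\<^sub>R (t *\<^sub>R y))"
    using mvt[OF t(3)] by blast
  have c1: "c (t *\<^sub>R y) > 0" and c2: "c (t' *\<^sub>R (t *\<^sub>R y)) > 0" using c(1) t t' by blast+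
  have "p \<bullet> y \<le> (p \<bullet> y) / c (t *\<^sub>R y)"
  proof (cases "p \<bullet> y \<ge> 0")
    case True
    then have "v (t *\<^sub>R y) - v 0 \<ge> 0" unfolding t'(4) using t(1) c2 by simp
    then have "c (t *\<^sub>R y) \<le> 1" using c_le[OF t(3)] by simp
    then have "(p \<bullet> y) * c (t *\<^sub>R y) \<le> (p \<bullet> y) * 1" using True by (intro mult_left_mono)
    then show ?thesis using c1 by (simp add: pos_le_divide_eq)
  next
    case False
    then have "v (t *\<^sub>R y) - v 0 \<le> 0"
      unfolding t'(4) using t(1) c2 by (simp add: divide_nonpos_pos mult_nonneg_nonpos)
    then have "1 \<le> c (t *\<^sub>R y)" using c_ge[OF t(3)] by simp
    then have "(p \<bullet> y) * c (t *\<^sub>R y) \<le> (p \<bullet> y) * 1" using False by (intro mult_left_mono_neg) auto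
    then show ?thesis using c1 by (simp add: pos_le_divide_eq)
  qed
  with t(4) show ?thesis by linarith
qed

section \<open>The critical parameter\<close>

text \<open>
  The supremum of the parameters for which \<open>F l\<close> lies below \<open>u\<close>. Slightly beyond it the inequality fails at some
  point, and equicontinuity in the parameter turns this failure into near-contact at the supremum itself.
\<close>

lemma ex_critical_parameter:
  fixes F :: "real \<Rightarrow> 'b \<Rightarrow> real"
  assumes "a < b"
    and uc: "\<And>e. e > 0 \<Longrightarrow> \<exists>d>0. \<forall>l\<in>{a..b}. \<forall>l'\<in>{a..b}. \<bar>l - l'\<bar> < d \<longrightarrow> (\<forall>y\<in>Y. \<bar>F l y - F l' y\<bar> < e)"
    and lo: "\<forall>y\<in>Y. F a y \<le> u y" and hi: "\<exists>y\<in>Y. u y < F b y"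
  shows "\<exists>l\<in>{a..b}. (\<forall>y\<in>Y. F l y \<le> u y) \<and> (INF y\<in>Y. ereal (u y - F l y)) = 0"
proof -
  define S where "S = {l\<in>{a..b}. \<forall>y\<in>Y. F l y \<le> u y}"
  define l where "l = Sup S"
  have "a \<in> S" using \<open>a < b\<close> lo by (simp add: S_def)
  have S: "S \<noteq> {}" "bdd_above S" using \<open>a \<in> S\<close> by (auto simp: S_def)
  have l_ab: "l \<in> {a..b}"
    unfolding l_def using \<open>a \<in> S\<close> cSup_upper[OF _ S(2)] cSup_least[OF S(1), of b] by (auto simp: S_def)
  have l_le: "F l y \<le> u y" if y: "y \<in> Y" for y
  proof (rule field_le_epsilon)
    fix e :: real assume "e > 0"
    then obtain d where d: "d > 0" "\<forall>l\<in>{a..b}. \<forall>l'\<in>{a..b}. \<bar>l - l'\<bar> < d \<longrightarrow> (\<forall>y\<in>Y. \<bar>F l y - F l' y\<bar> < e)"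
      using uc[OF \<open>e > 0\<close>] by blast
    then obtain l' where l': "l' \<in> S" "l - d < l'"
      using less_cSupD[OF S(1), of "l - d"] unfolding l_def by auto
    then have "l' \<le> l" unfolding l_def using cSup_upper[OF _ S(2)] by blast
    then have "\<bar>F l y - F l' y\<bar> < e" using d l' l_ab y by (auto simp: S_def)
    moreover have "F l' y \<le> u y" using l' y by (simp add: S_def)
    ultimately show "F l y \<le> u y + e" by linarith
  qed
  then have "l \<noteq> b" using hi by force
  then have "l < b" using l_ab by auto
  have small: "\<exists>y\<in>Y. u y - F l y < e" if e: "e > 0" for e
  proof -
    obtain d where d: "d > 0" "\<forall>l\<in>{a..b}. \<forall>l'\<in>{a..b}. \<bar>l - l'\<bar> < d \<longrightarrow> (\<forall>y\<in>Y. \<bar>F l y - F l' y\<bar> < e)"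
      using uc[OF e] by blast
    define l' where "l' = min b (l + d / 2)"
    have l': "l' \<in> {a..b}" "l < l'" "\<bar>l' - l\<bar> < d" using \<open>l < b\<close> l_ab d(1) by (auto simp: l'_def)
    then have "l' \<notin> S" using cSup_upper[OF _ S(2), of l'] by (auto simp: l_def)
    then obtain y where y: "y \<in> Y" "u y < F l' y" using l'(1) by (auto simp: S_def not_le)
    then have "\<bar>F l' y - F l y\<bar> < e" using d(2) l' l_ab by blast
    then show ?thesis using y by (intro bexI[of _ y]) linarith+
  qed
  have "(INF y\<in>Y. ereal (u y - F l y)) \<le> 0"
  proof (rule ereal_le_epsilon2)
    fix e :: real assume "e > 0"
    then obtain y where "y \<in> Y" "u y - F l y < e" using small by blast
    then show "(INF y\<in>Y. ereal (u y - F l y)) \<le> 0 + ereal e"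
      by (intro INF_lower2[of y]) auto
  qed
  moreover have "0 \<le> (INF y\<in>Y. ereal (u y - F l y))"
    using l_le by (intro INF_greatest) auto
  ultimately show ?thesis using l_ab l_le by (intro bexI[of _ l]) auto
qed

lemma frequently_less_of_Liminf_le_0:
  fixes w :: "'b \<Rightarrow> real"
  assumes "Liminf F (\<lambda>y. ereal (w y)) \<le> 0" "e > 0"
  shows "\<exists>\<^sub>F y in F. w y < e"
proof (rule ccontr)
  assume "\<not> (\<exists>\<^sub>F y in F. w y < e)"
  then have "\<forall>\<^sub>F y in F. ereal e \<le> ereal (w y)" by (simp add: frequently_def not_less)
  then have "ereal e \<le> Liminf F (\<lambda>y. ereal (w y))" by (rule Liminf_bounded)
  with assms show False using order_trans[of "ereal e" _ 0] by auto
qed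

text \<open>
  Lower limits are used only in this form: values of \<open>u\<close> below \<open>c + e\<close> occur arbitrarily close to \<open>a\<close>.
\<close>

lemma frequently_less_cluster:
  fixes u f :: "'a::topological_space \<Rightarrow> real"
  assumes "Liminf (at a) (\<lambda>y. ereal (u y - f y)) \<le> 0" "(f \<longlongrightarrow> c) (at a)" "e > 0"
  shows "\<exists>\<^sub>F y in at a. u y < c + e"
proof -
  have "\<exists>\<^sub>F y in at a. u y - f y < e / 2"
    using assms by (intro frequently_less_of_Liminf_le_0) auto
  moreover have "\<forall>\<^sub>F y in at a. f y < c + e / 2"
    using assms(2) by (rule order_tendstoD) (use assms in simp)
  ultimately have "\<exists>\<^sub>F y in at a. u y - f y < e / 2 \<and> f y < c + e / 2"
    by (rule frequently_eventually_frequently)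
  then show ?thesis by (rule frequently_elim1) linarith
qed

lemma Ck_on_1_gradient:
  fixes v :: "'a::euclidean_space \<Rightarrow> real"
  assumes "Ck_on 1 W v"
  defines "g \<equiv> \<lambda>x. \<Sum>i\<in>Basis. partial_deriv i v x *\<^sub>R i"
  shows "x \<in> W \<Longrightarrow> (v has_derivative (\<lambda>h. g x \<bullet> h)) (at x)" and "continuous_on W g"
proof -
  have W: "\<forall>x\<in>W. v differentiable (at x)" "\<forall>i\<in>Basis. continuous_on W (partial_deriv i v)"
    using assms by auto
  show "continuous_on W g" unfolding g_def using W by (intro continuous_intros) auto
  show "(v has_derivative (\<lambda>h. g x \<bullet> h)) (at x)" if "x \<in> W"
  proof -
    have D: "(v has_derivative frechet_derivative v (at x)) (at x)"
      using W that frechet_derivative_works by blast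
    have "frechet_derivative v (at x) h = g x \<bullet> h" for h
    proof -
      interpret linear "frechet_derivative v (at x)" using D has_derivative_linear by blast
      have "frechet_derivative v (at x) h = frechet_derivative v (at x) (\<Sum>i\<in>Basis. (h \<bullet> i) *\<^sub>R i)"
        by (simp add: euclidean_representation)
      also have "\<dots> = (\<Sum>i\<in>Basis. (h \<bullet> i) * partial_deriv i v x)"
        by (simp add: sum scale partial_deriv_def)
      also have "\<dots> = g x \<bullet> h"
        by (simp add: g_def inner_sum_left inner_commute[of h] inner_sum_right mult.commute)
      finally show ?thesis .
    qed
    then have "frechet_derivative v (at x) = (\<lambda>h. g x \<bullet> h)" by auto
    with D show ?thesis by simp
  qed
qed

text \<open>
  For small \<open>x\<close> and \<open>l\<close> near \<open>1\<close> the arguments \<open>x + \<xi> l *\<^sub>R y\<close> stay in the open set on which \<open>v\<close> is continuous, so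
  \<open>Phi\<close> is a continuous function of \<open>(x, l, y)\<close> on a compact set.
\<close>

lemma Phi_uniformly_continuous:
  fixes v :: "'a::euclidean_space \<Rightarrow> real"
  assumes "compact K" "open U" "K \<subseteq> U" and v: "continuous_on U v"
    and S: "open S" "1 \<in> S" "continuous_on S \<phi>" "continuous_on S \<psi>" "continuous_on S \<xi>"
    and "\<xi> 1 = 1"
  shows "\<exists>d\<^sub>0>0. (\<forall>e>0. \<exists>d>0. \<forall>x x' l l' y.
      norm x \<le> d\<^sub>0 \<and> norm x' \<le> d\<^sub>0 \<and> \<bar>l - 1\<bar> \<le> d\<^sub>0 \<and> \<bar>l' - 1\<bar> \<le> d\<^sub>0 \<and> y \<in> K \<and>
      norm (x - x') < d \<and> \<bar>l - l'\<bar> < d \<longrightarrow> \<bar>Phi \<phi> \<psi> \<xi> v x l y - Phi \<phi> \<psi> \<xi> v x' l' y\<bar> < e)"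
proof -
  obtain \<eta> where \<eta>: "\<eta> > 0" "(\<Union>x\<in>K. cball x \<eta>) \<subseteq> U"
    using compact_subset_open_imp_cball_epsilon_subset[OF assms(1-3)] by blast
  obtain B where B: "B > 0" "\<And>y. y \<in> K \<Longrightarrow> norm y \<le> B"
    using compact_imp_bounded[OF \<open>compact K\<close>] bounded_pos by blast
  have "isCont \<xi> 1" using S continuous_on_eq_continuous_at by blast
  then have "(\<xi> \<longlongrightarrow> \<xi> 1) (nhds 1)" unfolding isCont_def tendsto_at_iff_tendsto_nhds .
  then have "\<forall>\<^sub>F l in nhds 1. dist (\<xi> l) 1 < \<eta> / (2 * B)"
    unfolding \<open>\<xi> 1 = 1\<close> using \<eta> B by (intro tendstoD) auto
  moreover have "\<forall>\<^sub>F l in nhds 1. l \<in> S" using S by (intro eventually_nhds_in_open)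
  ultimately have "\<forall>\<^sub>F l in nhds 1. dist (\<xi> l) 1 < \<eta> / (2 * B) \<and> l \<in> S" by eventually_elim auto
  then obtain d1 where d1: "d1 > 0" "\<And>l. dist l 1 < d1 \<Longrightarrow> dist (\<xi> l) 1 < \<eta> / (2 * B) \<and> l \<in> S"
    unfolding eventually_nhds_metric by blast
  define d\<^sub>0 where "d\<^sub>0 = min (\<eta> / 2) (d1 / 2)"
  have d\<^sub>0: "d\<^sub>0 > 0" "d\<^sub>0 \<le> \<eta> / 2" "d\<^sub>0 < d1" using \<eta> d1 by (auto simp: d\<^sub>0_def)
  have l: "\<bar>\<xi> l - 1\<bar> < \<eta> / (2 * B)" "l \<in> S" if "l \<in> cball 1 d\<^sub>0" for l
    using d1(2)[of l] that d\<^sub>0 by (auto simp: dist_real_def abs_minus_commute)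
  have in_U: "x + \<xi> l *\<^sub>R y \<in> U" if "x \<in> cball 0 d\<^sub>0" "l \<in> cball 1 d\<^sub>0" "y \<in> K" for x l y
  proof -
    have "dist y (x + \<xi> l *\<^sub>R y) = norm (x + (\<xi> l - 1) *\<^sub>R y)"
      by (simp add: dist_norm norm_minus_commute algebra_simps)
    also have "\<dots> \<le> norm x + \<bar>\<xi> l - 1\<bar> * norm y" using norm_triangle_ineq[of x "(\<xi> l - 1) *\<^sub>R y"] by simp
    also have "\<bar>\<xi> l - 1\<bar> * norm y \<le> \<eta> / (2 * B) * B"
      using l[OF that(2)] B(2)[OF that(3)] by (intro mult_mono) auto
    finally have "dist y (x + \<xi> l *\<^sub>R y) \<le> \<eta>" using that(1) d\<^sub>0 B by simp
    then have "x + \<xi> l *\<^sub>R y \<in> cball y \<eta>" by simp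
    then show ?thesis using \<eta>(2) that(3) by blast
  qed
  define C where "C = cball (0::'a) d\<^sub>0 \<times> cball (1::real) d\<^sub>0 \<times> K"
  define F where "F p = Phi \<phi> \<psi> \<xi> v (fst p) (fst (snd p)) (snd (snd p))" for p :: "'a \<times> real \<times> 'a"
  have "compact C" unfolding C_def by (intro compact_Times \<open>compact K\<close>) auto
  moreover have "continuous_on C F"
  proof -
    have c: "continuous_on C (\<lambda>p. f (fst (snd p)))" if "continuous_on S f" for f :: "real \<Rightarrow> real"
      by (rule continuous_on_compose2[OF that]) (use l in \<open>auto simp: C_def intro!: continuous_intros\<close>)
    have "continuous_on C (\<lambda>p. v (fst p + \<xi> (fst (snd p)) *\<^sub>R snd (snd p)))"
      by (rule continuous_on_compose2[OF v])
        (use in_U in \<open>auto simp: C_def[symmetric] intro!: continuous_intros c[OF S(5)], auto simp: C_def\<close>)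
    then show ?thesis
      unfolding F_def Phi_def by (intro continuous_intros c S)
  qed
  ultimately have uc: "uniformly_continuous_on C F" by (rule compact_uniformly_continuous[rotated])
  show ?thesis
  proof (rule exI[of _ d\<^sub>0], intro conjI allI impI d\<^sub>0(1))
    fix e :: real assume "e > 0"
    then obtain d where d: "d > 0" "\<And>p p'. p \<in> C \<Longrightarrow> p' \<in> C \<Longrightarrow> dist p' p < d \<Longrightarrow> dist (F p') (F p) < e"
      using uc unfolding uniformly_continuous_on_def by metis
    show "\<exists>d>0. \<forall>x x' l l' y.
      norm x \<le> d\<^sub>0 \<and> norm x' \<le> d\<^sub>0 \<and> \<bar>l - 1\<bar> \<le> d\<^sub>0 \<and> \<bar>l' - 1\<bar> \<le> d\<^sub>0 \<and> y \<in> K \<and>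
      norm (x - x') < d \<and> \<bar>l - l'\<bar> < d \<longrightarrow> \<bar>Phi \<phi> \<psi> \<xi> v x l y - Phi \<phi> \<psi> \<xi> v x' l' y\<bar> < e"
    proof (intro exI[of _ "d / 2"] conjI allI impI)
      fix x x' y :: 'a and l l' :: real
      assume *: "norm x \<le> d\<^sub>0 \<and> norm x' \<le> d\<^sub>0 \<and> \<bar>l - 1\<bar> \<le> d\<^sub>0 \<and> \<bar>l' - 1\<bar> \<le> d\<^sub>0 \<and> y \<in> K \<and>
        norm (x - x') < d / 2 \<and> \<bar>l - l'\<bar> < d / 2"
      have "dist (x, l, y) (x', l', y) \<le> dist x x' + dist l l'"
        using sqrt_sum_squares_le_sum[of "dist x x'" "dist l l'"] by (simp add: dist_Pair_Pair)
      then have "dist (x, l, y) (x', l', y) < d" using * by (simp add: dist_norm)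
      with d(2)[of "(x', l', y)" "(x, l, y)"] *
      show "\<bar>Phi \<phi> \<psi> \<xi> v x l y - Phi \<phi> \<psi> \<xi> v x' l' y\<bar> < e"
        by (auto simp: C_def F_def dist_real_def abs_minus_commute)
    qed (use d in simp)
  qed
qed

lemma left_difference_quotient_tendsto:
  assumes "(f has_real_derivative D) (at a)"
  shows "((\<lambda>t. (f a - f (a - t)) / t) \<longlongrightarrow> D) (at_right 0)"
proof -
  have "((\<lambda>t. a - t) has_real_derivative -1) (at 0)"
    by (auto intro!: derivative_eq_intros)
  from DERIV_chain2[where f = f and g = "\<lambda>t. a - t", OF _ this] assms
  have "((\<lambda>t. f (a - t)) has_real_derivative - D) (at 0)" by simp
  then have "((\<lambda>t. (f (a - t) - f (a - 0)) / (t - 0)) \<longlongrightarrow> - D) (at_right 0)"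
    unfolding has_field_derivative_iff by (rule filterlim_mono) (auto intro: at_le)
  from tendsto_minus[OF this] show ?thesis
    by (simp add: minus_divide_left)
qed

text \<open>
  The radius \<open>r\<close> must not depend on \<open>t\<close>, because later \<open>t\<close> is chosen small in terms of the gap \<open>u - v\<close>
  outside the ball. The parameter \<open>1 - t\<close> lowers \<open>\<phi> l * v y + \<psi> l\<close> by at least a constant times \<open>t\<close>, while
  rescaling the argument by \<open>\<xi> (1 - t)\<close> changes \<open>v\<close> by at most a constant times \<open>t * norm y\<close>, since \<open>v\<close>
  is Lipschitz near the origin. For small \<open>norm y\<close> the first effect dominates.
\<close>

lemma Phi_below_near_origin:
  fixes v :: "'a::euclidean_space \<Rightarrow> real"
  assumes W: "open W" "0 \<in> W" and g: "\<And>x. x \<in> W \<Longrightarrow> (v has_derivative (\<lambda>h. g x \<bullet> h)) (at x)" "continuous_on W g"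
    and "v 0 > 0"
    and D: "(\<phi> has_real_derivative \<phi>') (at 1)" "(\<psi> has_real_derivative \<psi>') (at 1)"
      "(\<xi> has_real_derivative \<xi>') (at 1)"
    and at1: "\<phi> 1 = 1" "\<psi> 1 = 0" "\<xi> 1 = 1"
    and pos: "\<phi>' \<ge> 0" "\<psi>' \<ge> 0" "\<phi>' + \<psi>' > 0"
    and \<phi>_le: "\<forall>\<^sub>F t in at_right 0. \<phi> (1 - t) \<le> 1"
  shows "\<exists>r>0. \<exists>m>0. \<forall>\<^sub>F t in at_right 0. \<forall>y\<in>ball 0 r. Phi \<phi> \<psi> \<xi> v 0 (1 - t) y + m * t \<le> v y"
proof -
  define L where "L = norm (g 0) + 1"
  have "isCont g 0" "isCont v 0"
    using W g has_derivative_continuous continuous_on_eq_continuous_at by blast+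
  then have "(g \<longlongrightarrow> g 0) (nhds 0)" "(v \<longlongrightarrow> v 0) (nhds 0)"
    unfolding isCont_def tendsto_at_iff_tendsto_nhds .
  then have "\<forall>\<^sub>F x in nhds 0. norm (g x) < L" "\<forall>\<^sub>F x in nhds 0. v 0 / 2 < v x"
    using order_tendstoD(2)[OF tendsto_norm, of g "g 0" "nhds 0" L]
      order_tendstoD(1)[of v "v 0" "nhds 0" "v 0 / 2"] \<open>v 0 > 0\<close> by (auto simp: L_def)
  moreover have "\<forall>\<^sub>F x in nhds 0. x \<in> W" using W by (intro eventually_nhds_in_open)
  ultimately have "\<forall>\<^sub>F x in nhds 0. norm (g x) < L \<and> v 0 / 2 < v x \<and> x \<in> W"
    by eventually_elim auto
  then obtain R where R: "R > 0" "\<And>x. x \<in> ball 0 R \<Longrightarrow> norm (g x) < L \<and> v 0 / 2 < v x \<and> x \<in> W"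
    unfolding eventually_nhds_metric by (auto simp: dist_commute)
  have L: "L > 0" unfolding L_def using norm_ge_zero[of "g 0"] by linarith
  have lip: "\<bar>v y - v z\<bar> \<le> L * norm (y - z)" if "y \<in> ball 0 R" "z \<in> ball 0 R" for y z
  proof -
    have "norm (v y - v z) \<le> L * norm (y - z)"
    proof (rule differentiable_bound[OF convex_ball _ _ that])
      fix x :: 'a assume x: "x \<in> ball 0 R"
      then show "(v has_derivative (\<lambda>h. g x \<bullet> h)) (at x within ball 0 R)"
        using g(1) R(2) has_derivative_at_withinI by blast
      show "onorm (\<lambda>h. g x \<bullet> h) \<le> L"
      proof (rule onorm_le)
        fix h
        have "\<bar>g x \<bullet> h\<bar> \<le> norm (g x) * norm h" by (rule Cauchy_Schwarz_ineq2)
        also have "\<dots> \<le> L * norm h" using R(2)[OF x] by (intro mult_right_mono) auto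
        finally show "norm (g x \<bullet> h) \<le> L * norm h" by simp
      qed
    qed
    then show ?thesis by simp
  qed
  \<comment> \<open>On the ball \<open>v\<close> exceeds \<open>v 0 / 2\<close>, so replacing \<open>v\<close> by this constant bounds the decrease from below.\<close>
  define G where "G l = \<phi> l * (v 0 / 2) + \<psi> l" for l
  define m where "m = (\<phi>' * (v 0 / 2) + \<psi>') / 2"
  have "\<phi>' * (v 0 / 2) + \<psi>' > 0"
    using pos \<open>v 0 > 0\<close> by (cases "\<psi>' > 0") (auto simp: add_nonneg_pos)
  then have m: "m > 0" "m < \<phi>' * (v 0 / 2) + \<psi>'" by (auto simp: m_def)
  have "(G has_real_derivative (\<phi>' * (v 0 / 2) + \<psi>')) (at 1)"
    unfolding G_def[abs_def] using D by (auto intro!: derivative_eq_intros)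
  from order_tendstoD(1)[OF left_difference_quotient_tendsto[OF this] m(2)]
  have ev_G: "\<forall>\<^sub>F t in at_right 0. m < (G 1 - G (1 - t)) / t" .
  define M where "M = \<bar>\<xi>'\<bar> + 1"
  have ev_\<xi>: "\<forall>\<^sub>F t in at_right 0. \<bar>(\<xi> 1 - \<xi> (1 - t)) / t\<bar> < M"
    by (rule order_tendstoD(2)[OF tendsto_rabs[OF left_difference_quotient_tendsto[OF D(3)]]])
      (simp add: M_def)
  have M: "M > 0" by (simp add: M_def add_nonneg_pos)
  define r where "r = min (R / 2) (m / (2 * (L * M)))"
  have r: "r > 0" "r \<le> R / 2" "L * M * r \<le> m / 2"
    using R m L M by (auto simp: r_def min_def field_simps)
  have "\<forall>\<^sub>F t in at_right 0. t < 1 / M" "\<forall>\<^sub>F t in at_right (0::real). 0 < t"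
    using M by (auto simp: eventually_at_right_less intro!: order_tendstoD[OF tendsto_ident_at])
  with ev_G ev_\<xi> \<phi>_le
  have "\<forall>\<^sub>F t in at_right 0. \<forall>y\<in>ball 0 r. Phi \<phi> \<psi> \<xi> v 0 (1 - t) y + m / 2 * t \<le> v y"
  proof eventually_elim
    case (elim t)
    have \<xi>: "\<bar>1 - \<xi> (1 - t)\<bar> \<le> M * t" "\<bar>1 - \<xi> (1 - t)\<bar> \<le> 1"
      using elim at1 M by (auto simp: abs_divide field_simps)
    have G: "m * t \<le> G 1 - G (1 - t)" using elim by (simp add: field_simps)
    show ?case
    proof
      fix y :: 'a assume y: "y \<in> ball 0 r"
      have ny: "norm y < r" using y by simp
      have "\<bar>\<xi> (1 - t)\<bar> \<le> 2" using \<xi>(2) by linarith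
      then have "norm (\<xi> (1 - t) *\<^sub>R y) \<le> 2 * norm y" by (simp add: mult_right_mono)
      then have z: "\<xi> (1 - t) *\<^sub>R y \<in> ball 0 R" and y': "y \<in> ball 0 R" using ny r by auto
      have "\<bar>v y - v (\<xi> (1 - t) *\<^sub>R y)\<bar> \<le> L * norm ((1 - \<xi> (1 - t)) *\<^sub>R y)"
        using lip[OF y' z] by (simp add: scaleR_diff_left)
      also have "\<dots> = L * (\<bar>1 - \<xi> (1 - t)\<bar> * norm y)" by simp
      also have "\<dots> \<le> L * ((M * t) * r)"
        using \<xi>(1) ny L M elim by (intro mult_left_mono mult_mono) auto
      also have "\<dots> = (L * M * r) * t" by simp
      also have "\<dots> \<le> m / 2 * t" using r(3) elim by (intro mult_right_mono) auto
      finally have e1: "v (\<xi> (1 - t) *\<^sub>R y) - m / 2 * t \<le> v y" by linarith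
      have "(1 - \<phi> (1 - t)) * (v 0 / 2) \<le> (1 - \<phi> (1 - t)) * v (\<xi> (1 - t) *\<^sub>R y)"
        using R(2)[OF z] elim(3) by (intro mult_left_mono) auto
      then have "\<phi> (1 - t) * v (\<xi> (1 - t) *\<^sub>R y) + \<psi> (1 - t) \<le> v (\<xi> (1 - t) *\<^sub>R y) - (G 1 - G (1 - t))"
        using at1 by (simp add: G_def left_diff_distrib)
      with e1 G show "Phi \<phi> \<psi> \<xi> v 0 (1 - t) y + m / 2 * t \<le> v y"
        by (simp add: Phi_def)
    qed
  qed
  then show ?thesis using r m by (intro exI[of _ r] exI[of _ "m / 2"] conjI) auto
qed

section \<open>Positivity of the lower limit\<close>

theorem theorem1p10:
  fixes \<phi> \<psi> \<xi> :: "real \<Rightarrow> real"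
    and u v :: "'a::euclidean_space \<Rightarrow> real"
    and \<Omega> :: "'a set"
  assumes "DIM('a) \<ge> 2"
    and "\<exists>S. open S \<and> 1 \<in> S \<and>
           \<phi> C1_differentiable_on S \<and> \<psi> C1_differentiable_on S \<and> \<xi> C1_differentiable_on S"
    and "\<phi> 1 = 1" and "\<xi> 1 = 1" and "\<psi> 1 = 0"
    and "\<forall>\<^sub>F l in nhds 1. deriv \<phi> l \<ge> 0"
    and "\<forall>\<^sub>F l in nhds 1. deriv \<psi> l \<ge> 0"
    and "\<forall>\<^sub>F l in nhds 1. deriv \<phi> l + deriv \<psi> l > 0"
    and "\<forall>\<^sub>F l in nhds 1. deriv \<phi> l * \<xi> l + \<phi> l * deriv \<xi> l \<ge> 0"
    and "bounded \<Omega>" and "open \<Omega>" and "0 \<in> \<Omega>"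
    and "continuous_on (closure \<Omega> - {0}) u"
    and "\<exists>U. open U \<and> closure \<Omega> \<subseteq> U \<and> continuous_on U v"
    and "\<exists>W. open W \<and> 0 \<in> W \<and> Ck_on 1 W v"
    and "\<forall>x\<in>closure \<Omega>. v x > 0"
    and "\<forall>x\<in>closure \<Omega> - {0}. u x > v x"
    and "laplacian_nonpos_distr (\<Omega> - {0}) u"
    and "\<exists>\<epsilon>\<^sub>4>0. \<forall>x l. norm x < \<epsilon>\<^sub>4 \<and> \<bar>l - 1\<bar> < \<epsilon>\<^sub>4 \<longrightarrow>
           (INF y\<in>\<Omega> - {0}. ereal (u y - Phi \<phi> \<psi> \<xi> v x l y)) = 0 \<longrightarrow>
           Liminf (at 0) (\<lambda>y. ereal (u y - Phi \<phi> \<psi> \<xi> v x l y)) = 0"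
  shows "Liminf (at 0) (\<lambda>x. ereal (u x - v x)) > 0"
proof (rule ccontr)
  note dim = assms(1) and at1 = assms(3-5) and bdd = assms(10) and openO = assms(11) and O0 = assms(12)
    and u_cont = assms(13) and v_pos = assms(16) and u_gt = assms(17) and super = assms(18)
  assume "\<not> Liminf (at 0) (\<lambda>x. ereal (u x - v x)) > 0"
  then have liminf_le: "Liminf (at 0) (\<lambda>x. ereal (u x - v x)) \<le> 0" by simp
  obtain S where S: "open S" "1 \<in> S" and C1: "\<phi> C1_differentiable_on S" "\<psi> C1_differentiable_on S"
    "\<xi> C1_differentiable_on S"
    using assms(2) by blast
  obtain Uv where Uv: "open Uv" "closure \<Omega> \<subseteq> Uv" "continuous_on Uv v" using assms(14) by blast
  obtain W where W: "open W" "0 \<in> W" and v_C1: "Ck_on 1 W v" using assms(15) by blast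
  obtain \<epsilon>4 where \<epsilon>4: "\<epsilon>4 > 0" "\<And>x l. norm x < \<epsilon>4 \<Longrightarrow> \<bar>l - 1\<bar> < \<epsilon>4 \<Longrightarrow>
      (INF y\<in>\<Omega> - {0}. ereal (u y - Phi \<phi> \<psi> \<xi> v x l y)) = 0 \<Longrightarrow>
      Liminf (at 0) (\<lambda>y. ereal (u y - Phi \<phi> \<psi> \<xi> v x l y)) = 0"
    using assms(19) by blast
  have O_cl: "\<Omega> \<subseteq> closure \<Omega>" by (rule closure_subset)
  have v0: "v 0 > 0" using v_pos O0 O_cl by blast
  define g where "g x = (\<Sum>i\<in>Basis. partial_deriv i v x *\<^sub>R i)" for x
  have g: "\<And>x. x \<in> W \<Longrightarrow> (v has_derivative (\<lambda>h. g x \<bullet> h)) (at x)" "continuous_on W g"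
    using Ck_on_1_gradient[OF v_C1] by (simp_all add: g_def[abs_def])
  have v_cont: "isCont v x" if "x \<in> W" for x
    using g(1)[OF that] has_derivative_continuous by blast
  define U where "U = \<Omega> - {0}"
  have U: "open U" "0 \<notin> U" "continuous_on U u" "laplacian_nonpos_distr U u"
    using openO super continuous_on_subset[OF u_cont Diff_mono[OF O_cl order_refl]]
    by (auto simp: U_def open_delete)
  have U_ev: "\<forall>\<^sub>F y in at 0. y \<in> U"
  proof -
    have "\<forall>\<^sub>F y in at 0. y \<in> \<Omega>" "\<forall>\<^sub>F y in at (0::'a). y \<noteq> 0"
      using eventually_at_in_open'[OF openO O0] by (auto simp: eventually_at_filter)
    then show ?thesis by eventually_elim (simp add: U_def)
  qed
  have u_gt_ev: "\<forall>\<^sub>F y in at 0. v y < u y"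
    using U_ev by eventually_elim (use u_gt O_cl in \<open>auto simp: U_def\<close>)
  have v_tendsto: "(v \<longlongrightarrow> v 0) (at 0)" using v_cont[OF W(2)] by (simp add: isCont_def)
  note cluster = frequently_less_cluster[OF liminf_le v_tendsto]
  note touch = distr_superharmonic_touching_gradients_eq[OF dim U(1) U_ev U(2-4) cluster]

  have DS: "(f has_real_derivative deriv f l) (at l)" "continuous_on S f"
    if "f C1_differentiable_on S" "l \<in> S" for f :: "real \<Rightarrow> real" and l
  proof -
    have "f differentiable (at x)" if "x \<in> S" for x
      using \<open>f C1_differentiable_on S\<close> that
      by (auto simp: C1_differentiable_on_def differentiable_def has_vector_derivative_def)
    then show "(f has_real_derivative deriv f l) (at l)" "continuous_on S f"
      using that(2) DERIV_deriv_iff_real_differentiable continuous_at_imp_continuous_on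
        differentiable_imp_continuous_within by blast+
  qed
  have near1: "\<forall>\<^sub>F l in nhds 1. f l > 0" if "f C1_differentiable_on S" "f 1 = 1" for f :: "real \<Rightarrow> real"
  proof -
    have "isCont f 1" using DS(2)[OF that(1) S(2)] S continuous_on_eq_continuous_at by blast
    then have "(f \<longlongrightarrow> f 1) (nhds 1)" unfolding isCont_def tendsto_at_iff_tendsto_nhds .
    then show ?thesis by (rule order_tendstoD) (simp add: that)
  qed
  have "\<forall>\<^sub>F l in nhds 1. l \<in> S \<and> deriv \<phi> l \<ge> 0 \<and> deriv \<psi> l \<ge> 0 \<and> deriv \<phi> l + deriv \<psi> l > 0 \<and>
      deriv \<phi> l * \<xi> l + \<phi> l * deriv \<xi> l \<ge> 0 \<and> \<phi> l > 0 \<and> \<xi> l > 0"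
    using eventually_nhds_in_open[OF S] assms(6-9) near1[OF C1(1) at1(1)] near1[OF C1(3) at1(2)]
    by eventually_elim auto
  then obtain \<delta>0 where \<delta>0: "\<delta>0 > 0" "\<And>l. \<bar>l - 1\<bar> < \<delta>0 \<Longrightarrow> l \<in> S"
    "\<And>l. \<bar>l - 1\<bar> < \<delta>0 \<Longrightarrow> deriv \<phi> l \<ge> 0" "\<And>l. \<bar>l - 1\<bar> < \<delta>0 \<Longrightarrow> deriv \<psi> l \<ge> 0"
    "\<And>l. \<bar>l - 1\<bar> < \<delta>0 \<Longrightarrow> deriv \<phi> l + deriv \<psi> l > 0"
    "\<And>l. \<bar>l - 1\<bar> < \<delta>0 \<Longrightarrow> deriv \<phi> l * \<xi> l + \<phi> l * deriv \<xi> l \<ge> 0"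
    "\<And>l. \<bar>l - 1\<bar> < \<delta>0 \<Longrightarrow> \<phi> l > 0" "\<And>l. \<bar>l - 1\<bar> < \<delta>0 \<Longrightarrow> \<xi> l > 0"
    unfolding eventually_nhds_metric dist_real_def by auto
  \<comment> \<open>On this interval around \<open>1\<close> the map \<open>H\<close> is strictly increasing, since \<open>v 0 > 0\<close> and the derivatives of \<open>\<phi>\<close> and \<open>\<psi>\<close> are nonnegative and not both zero.\<close>
  define H where "H l = \<phi> l * v 0 + \<psi> l" for l
  have between: "\<bar>x - 1\<bar> < \<delta>0" if "\<bar>l - 1\<bar> < \<delta>0" "\<bar>l' - 1\<bar> < \<delta>0" "l \<le> x" "x \<le> l'" for l l' x :: real
    using that by linarith
  have H_mono: "H l < H l'" if "l < l'" "\<bar>l - 1\<bar> < \<delta>0" "\<bar>l' - 1\<bar> < \<delta>0" for l l'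
  proof (rule DERIV_pos_imp_increasing[OF that(1)])
    fix x assume "l \<le> x" "x \<le> l'"
    then have x: "\<bar>x - 1\<bar> < \<delta>0" using between that by blast
    have "(H has_real_derivative deriv \<phi> x * v 0 + deriv \<psi> x) (at x)"
      unfolding H_def[abs_def] using DS(1)[OF C1(1) \<delta>0(2)[OF x]] DS(1)[OF C1(2) \<delta>0(2)[OF x]]
      by (auto intro!: derivative_eq_intros)
    moreover have "deriv \<phi> x * v 0 + deriv \<psi> x > 0"
      using \<delta>0(3,4,5)[OF x] v0 by (cases "deriv \<psi> x > 0") (auto simp: add_nonneg_pos)
    ultimately show "\<exists>y. (H has_real_derivative y) (at x) \<and> 0 < y" by blast
  qed
  have \<phi>_mono: "\<phi> l \<le> \<phi> l'" if "l \<le> l'" "\<bar>l - 1\<bar> < \<delta>0" "\<bar>l' - 1\<bar> < \<delta>0" for l l'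
  proof (rule DERIV_nonneg_imp_nondecreasing[OF that(1)])
    fix x assume "l \<le> x" "x \<le> l'"
    then have x: "\<bar>x - 1\<bar> < \<delta>0" using between that by blast
    then show "\<exists>y. (\<phi> has_real_derivative y) (at x) \<and> 0 \<le> y"
      using DS(1)[OF C1(1) \<delta>0(2)[OF x]] \<delta>0(3)[OF x] by blast
  qed
  have \<phi>\<xi>_mono: "\<phi> l * \<xi> l \<le> \<phi> l' * \<xi> l'" if "l \<le> l'" "\<bar>l - 1\<bar> < \<delta>0" "\<bar>l' - 1\<bar> < \<delta>0" for l l'
  proof (rule DERIV_nonneg_imp_nondecreasing[OF that(1)])
    fix x assume "l \<le> x" "x \<le> l'"
    then have x: "\<bar>x - 1\<bar> < \<delta>0" using between that by blast
    have "((\<lambda>l. \<phi> l * \<xi> l) has_real_derivative deriv \<phi> x * \<xi> x + \<phi> x * deriv \<xi> x) (at x)"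
      using DERIV_mult[OF DS(1)[OF C1(1) \<delta>0(2)[OF x]] DS(1)[OF C1(3) \<delta>0(2)[OF x]]]
      by (simp add: algebra_simps)
    then show "\<exists>y. ((\<lambda>l. \<phi> l * \<xi> l) has_real_derivative y) (at x) \<and> 0 \<le> y"
      using \<delta>0(6)[OF x] by blast
  qed

  have K: "compact (closure \<Omega>)" using bdd by (simp add: compact_closure)
  obtain d0 where d0: "d0 > 0" and UC: "\<And>e. e > 0 \<Longrightarrow> \<exists>d>0. \<forall>x x' l l' y.
      norm x \<le> d0 \<and> norm x' \<le> d0 \<and> \<bar>l - 1\<bar> \<le> d0 \<and> \<bar>l' - 1\<bar> \<le> d0 \<and> y \<in> closure \<Omega> \<and>
      norm (x - x') < d \<and> \<bar>l - l'\<bar> < d \<longrightarrow> \<bar>Phi \<phi> \<psi> \<xi> v x l y - Phi \<phi> \<psi> \<xi> v x' l' y\<bar> < e"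
    using Phi_uniformly_continuous[OF K Uv(1,2,3) S DS(2)[OF C1(1) S(2)] DS(2)[OF C1(2) S(2)]
        DS(2)[OF C1(3) S(2)] at1(2)] by blast
  have Phi_id: "Phi \<phi> \<psi> \<xi> v 0 1 y = v y" for y by (simp add: Phi_def at1)
  have one: "\<bar>1 - 1\<bar> < \<delta>0" using \<delta>0(1) by simp
  have right: "\<forall>\<^sub>F t in at_right (0::real). 0 < t" "\<forall>\<^sub>F t in at_right 0. t < c" if "c > 0" for c :: real
    using eventually_at_right_less[of "0::real"] order_tendstoD(2)[OF tendsto_ident_at that] by auto
  have "\<forall>\<^sub>F t in at_right 0. \<phi> (1 - t) \<le> 1"
    using right[OF \<delta>0(1)] by eventually_elim (use \<phi>_mono[of _ 1] at1 one in auto)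
  then obtain r m where r: "r > 0" and m: "m > 0"
    and lower_near: "\<forall>\<^sub>F t in at_right 0. \<forall>y\<in>ball 0 r. Phi \<phi> \<psi> \<xi> v 0 (1 - t) y + m * t \<le> v y"
    using Phi_below_near_origin[OF W g v0 DS(1)[OF C1(1) S(2)] DS(1)[OF C1(2) S(2)]
        DS(1)[OF C1(3) S(2)] at1(1,3,2) \<delta>0(3-5)[OF one]] by blast
  obtain c where c: "c > 0" "\<And>y. y \<in> closure \<Omega> - ball 0 r \<Longrightarrow> c \<le> u y - v y"
  proof (cases "closure \<Omega> - ball 0 r = {}")
    case True
    show ?thesis by (rule that[of 1]) (use True in auto)
  next
    case False
    have "closure \<Omega> - ball 0 r \<subseteq> closure \<Omega> - {0}" using r by auto
    then have "continuous_on (closure \<Omega> - ball 0 r) (\<lambda>y. u y - v y)"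
      using Uv by (intro continuous_intros continuous_on_subset[OF u_cont] continuous_on_subset[OF Uv(3)]) auto
    moreover have "compact (closure \<Omega> - ball 0 r)" using K by (simp add: compact_diff)
    ultimately obtain y1 where y1: "y1 \<in> closure \<Omega> - ball 0 r" "\<forall>y\<in>closure \<Omega> - ball 0 r. u y1 - v y1 \<le> u y - v y"
      using continuous_attains_inf[of "closure \<Omega> - ball 0 r" "\<lambda>y. u y - v y"] False by blast
    have "y1 \<noteq> 0" using y1(1) r by auto
    then have "u y1 - v y1 > 0" using u_gt y1(1) by force
    then show ?thesis using that[of "u y1 - v y1"] y1(2) by blast
  qed
  obtain d1 where d1: "d1 > 0" "\<And>x x' l l' y.
      norm x \<le> d0 \<and> norm x' \<le> d0 \<and> \<bar>l - 1\<bar> \<le> d0 \<and> \<bar>l' - 1\<bar> \<le> d0 \<and> y \<in> closure \<Omega> \<and>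
      norm (x - x') < d1 \<and> \<bar>l - l'\<bar> < d1 \<longrightarrow> \<bar>Phi \<phi> \<psi> \<xi> v x l y - Phi \<phi> \<psi> \<xi> v x' l' y\<bar> < c / 2"
    using UC[of "c / 2"] c(1) by auto
  \<comment> \<open>At \<open>l = 1 - \<delta>\<close> the family starts below \<open>u\<close>: near the origin by the previous estimate, elsewhere because \<open>u - v\<close> is bounded below by \<open>c\<close>.\<close>
  define dd where "dd = Min {\<delta>0, d0, d1, \<epsilon>4}"
  have dd: "dd > 0" "dd \<le> \<delta>0" "dd \<le> d0" "dd \<le> d1" "dd \<le> \<epsilon>4"
    using \<delta>0(1) d0 d1(1) \<epsilon>4(1) by (auto simp: dd_def)
  have "\<forall>\<^sub>F t in at_right 0. 0 < t \<and> t < dd \<and> (\<forall>y\<in>ball 0 r. Phi \<phi> \<psi> \<xi> v 0 (1 - t) y + m * t \<le> v y)"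
    using right[OF dd(1)] lower_near by eventually_elim auto
  then obtain \<delta> where \<delta>: "0 < \<delta>" "\<delta> < dd" and
    \<delta>_near: "\<And>y. y \<in> ball 0 r \<Longrightarrow> Phi \<phi> \<psi> \<xi> v 0 (1 - \<delta>) y + m * \<delta> \<le> v y"
    using eventually_happens'[OF trivial_limit_at_right_real] by blast
  define c' where "c' = min (c / 2) (m * \<delta>)"
  have c': "c' > 0" using c m \<delta> by (simp add: c'_def)
  have start: "Phi \<phi> \<psi> \<xi> v 0 (1 - \<delta>) y + c' \<le> u y" if y: "y \<in> U" for y
  proof (cases "y \<in> ball 0 r")
    case True
    have "v y < u y" using y u_gt O_cl by (auto simp: U_def)
    then show ?thesis using \<delta>_near[OF True] by (simp add: c'_def)
  next
    case False
    have yO: "y \<in> closure \<Omega>" using y O_cl by (auto simp: U_def)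
    have "\<bar>Phi \<phi> \<psi> \<xi> v 0 (1 - \<delta>) y - v y\<bar> < c / 2"
      using d1(2)[of 0 0 "1 - \<delta>" 1 y] \<delta> dd d0 d1(1) yO by (simp add: Phi_id)
    then have "Phi \<phi> \<psi> \<xi> v 0 (1 - \<delta>) y - v y < c / 2"
      by (rule le_less_trans[OF abs_ge_self])
    moreover have "c \<le> u y - v y" using c(2) yO False by blast
    moreover have "c' \<le> c / 2" by (simp add: c'_def)
    ultimately show ?thesis by linarith
  qed
  \<comment> \<open>At \<open>l = 1 + \<delta>\<close> the value at the origin already exceeds the lower limit \<open>v 0\<close> of \<open>u\<close>.\<close>
  have "H (1 + \<delta>) > H 1" using \<delta> dd by (intro H_mono) auto
  then have gap: "Phi \<phi> \<psi> \<xi> v 0 (1 + \<delta>) 0 - v 0 > 0" by (simp add: Phi_def H_def at1)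
  obtain d2 where d2: "d2 > 0" "\<And>x x' l l' y.
      norm x \<le> d0 \<and> norm x' \<le> d0 \<and> \<bar>l - 1\<bar> \<le> d0 \<and> \<bar>l' - 1\<bar> \<le> d0 \<and> y \<in> closure \<Omega> \<and>
      norm (x - x') < d2 \<and> \<bar>l - l'\<bar> < d2 \<longrightarrow> \<bar>Phi \<phi> \<psi> \<xi> v x l y - Phi \<phi> \<psi> \<xi> v x' l' y\<bar> < min c' (Phi \<phi> \<psi> \<xi> v 0 (1 + \<delta>) 0 - v 0)"
    using UC[of "min c' (Phi \<phi> \<psi> \<xi> v 0 (1 + \<delta>) 0 - v 0)"] c' gap by auto
  obtain R where R: "R > 0" "ball 0 R \<subseteq> W" using W open_contains_ball by blast
  define \<rho> where "\<rho> = Min {R, d0, d2, \<epsilon>4}"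
  have \<rho>: "\<rho> > 0" "\<rho> \<le> R" "\<rho> \<le> d0" "\<rho> \<le> d2" "\<rho> \<le> \<epsilon>4"
    using R(1) d0 d2(1) \<epsilon>4(1) by (auto simp: \<rho>_def)

  have Phi_deriv: "((\<lambda>y. Phi \<phi> \<psi> \<xi> v x l y) has_derivative (\<lambda>h. ((\<phi> l * \<xi> l) *\<^sub>R g x) \<bullet> h)) (at 0)"
    if "x \<in> W" for x l
  proof -
    have "((\<lambda>y. x + \<xi> l *\<^sub>R y) has_derivative (\<lambda>h. \<xi> l *\<^sub>R h)) (at 0)"
      by (auto intro!: derivative_eq_intros)
    moreover have "(v has_derivative (\<lambda>h. g x \<bullet> h)) (at (x + \<xi> l *\<^sub>R 0))" using g(1)[OF that] by simp
    ultimately have "((\<lambda>y. v (x + \<xi> l *\<^sub>R y)) has_derivative (\<lambda>h. g x \<bullet> (\<xi> l *\<^sub>R h))) (at 0)"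
      by (rule has_derivative_compose)
    then show ?thesis
      unfolding Phi_def by (auto intro!: derivative_eq_intros simp: algebra_simps)
  qed

  \<comment> \<open>Contact at the origin gives the first equation; the second compares gradients with \<open>v\<close> itself, which also touches \<open>u\<close> there.\<close>
  have ex_l: "\<exists>l. \<bar>l - 1\<bar> < \<delta>0 \<and> \<phi> l * v x + \<psi> l = v 0 \<and> (\<phi> l * \<xi> l) *\<^sub>R g x = g 0"
    if x: "x \<in> ball 0 \<rho>" for x
  proof -
    have xW: "x \<in> W" and nx: "norm x < \<rho>" using x R \<rho> by auto
    let ?F = "\<lambda>l y. Phi \<phi> \<psi> \<xi> v x l y"
    have F_tendsto: "((\<lambda>y. ?F l y) \<longlongrightarrow> ?F l 0) (at 0)" for l
      using has_derivative_continuous[OF Phi_deriv[OF xW]] by (simp add: continuous_within)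
    have "\<exists>l\<in>{1 - \<delta>..1 + \<delta>}. (\<forall>y\<in>U. ?F l y \<le> u y) \<and> (INF y\<in>U. ereal (u y - ?F l y)) = 0"
    proof (rule ex_critical_parameter)
      show "1 - \<delta> < 1 + \<delta>" using \<delta> by simp
      show "\<exists>d>0. \<forall>l\<in>{1 - \<delta>..1 + \<delta>}. \<forall>l'\<in>{1 - \<delta>..1 + \<delta>}. \<bar>l - l'\<bar> < d \<longrightarrow> (\<forall>y\<in>U. \<bar>?F l y - ?F l' y\<bar> < e)"
        if e: "e > 0" for e
      proof -
        obtain d where d: "d > 0" "\<And>x x' l l' y.
          norm x \<le> d0 \<and> norm x' \<le> d0 \<and> \<bar>l - 1\<bar> \<le> d0 \<and> \<bar>l' - 1\<bar> \<le> d0 \<and> y \<in> closure \<Omega> \<and>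
          norm (x - x') < d \<and> \<bar>l - l'\<bar> < d \<longrightarrow> \<bar>Phi \<phi> \<psi> \<xi> v x l y - Phi \<phi> \<psi> \<xi> v x' l' y\<bar> < e"
          using UC[OF e] by blast
        have "\<bar>?F l y - ?F l' y\<bar> < e"
          if "l \<in> {1 - \<delta>..1 + \<delta>}" "l' \<in> {1 - \<delta>..1 + \<delta>}" "\<bar>l - l'\<bar> < d" "y \<in> U" for l l' y
          using d(2)[of x x l l' y] d(1) that \<delta> dd \<rho> nx O_cl by (auto simp: U_def abs_le_iff)
        then show ?thesis using d(1) by blast
      qed
      show "\<forall>y\<in>U. ?F (1 - \<delta>) y \<le> u y"
      proof
        fix y assume y: "y \<in> U"
        have "\<bar>?F (1 - \<delta>) y - Phi \<phi> \<psi> \<xi> v 0 (1 - \<delta>) y\<bar> < c'"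
          using d2(2)[of x 0 "1 - \<delta>" "1 - \<delta>" y] d2(1) \<delta> dd \<rho> nx y O_cl d0 by (auto simp: U_def)
        then show "?F (1 - \<delta>) y \<le> u y" using start[OF y] by linarith
      qed
      have "\<bar>?F (1 + \<delta>) 0 - Phi \<phi> \<psi> \<xi> v 0 (1 + \<delta>) 0\<bar> < Phi \<phi> \<psi> \<xi> v 0 (1 + \<delta>) 0 - v 0"
        using d2(2)[of x 0 "1 + \<delta>" "1 + \<delta>" 0] d2(1) \<delta> dd \<rho> nx O0 O_cl d0 by auto
      then have "?F (1 + \<delta>) 0 > v 0" by linarith
      then obtain e where e: "e > 0" "v 0 + e < ?F (1 + \<delta>) 0"
        by (metis add.commute field_lbound_gt_zero less_diff_eq diff_gt_0_iff_gt)
      have "\<forall>\<^sub>F y in at 0. v 0 + e < ?F (1 + \<delta>) y \<and> y \<in> U"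
        using order_tendstoD(1)[OF F_tendsto e(2)] U_ev by eventually_elim auto
      with cluster[OF e(1)] have "\<exists>\<^sub>F y in at 0. u y < v 0 + e \<and> v 0 + e < ?F (1 + \<delta>) y \<and> y \<in> U"
        by (rule frequently_eventually_frequently)
      then have "\<exists>y. u y < v 0 + e \<and> v 0 + e < ?F (1 + \<delta>) y \<and> y \<in> U"
        by (rule frequently_ex)
      then show "\<exists>y\<in>U. u y < ?F (1 + \<delta>) y" using less_trans by blast
    qed
    then obtain l where l: "l \<in> {1 - \<delta>..1 + \<delta>}" "\<And>y. y \<in> U \<Longrightarrow> ?F l y \<le> u y"
      "(INF y\<in>U. ereal (u y - ?F l y)) = 0"
      by blast
    have l1: "\<bar>l - 1\<bar> < \<delta>0" "\<bar>l - 1\<bar> < \<epsilon>4" using l(1) \<delta> dd by (auto simp: abs_less_iff)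
    have "norm x < \<epsilon>4" using nx \<rho> by simp
    then have "Liminf (at 0) (\<lambda>y. ereal (u y - ?F l y)) = 0"
      using \<epsilon>4(2)[of x l] l1(2) l(3) by (simp add: U_def)
    then have cluster_F: "\<exists>\<^sub>F y in at 0. u y < ?F l 0 + e" if "e > 0" for e
      using that by (intro frequently_less_cluster[OF _ F_tendsto]) auto
    have F_le: "\<forall>\<^sub>F y in at 0. ?F l y \<le> u y" using U_ev by eventually_elim (rule l(2))
    have le: "b \<le> a" if "\<And>e. e > 0 \<Longrightarrow> \<exists>\<^sub>F y in at 0. u y < a + e" "(f \<longlongrightarrow> b) (at 0)" "\<forall>\<^sub>F y in at 0. f y \<le> u y"
      for a b :: real and f
    proof (rule ccontr)
      assume "\<not> b \<le> a"
      then have e: "(b - a) / 2 > 0" by simp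
      have "\<forall>\<^sub>F y in at 0. (a + b) / 2 < f y"
        by (rule order_tendstoD(1)[OF that(2)]) (use e in \<open>simp add: field_simps\<close>)
      then have "\<forall>\<^sub>F y in at 0. \<not> u y < a + (b - a) / 2"
        using that(3) by eventually_elim (simp add: field_simps)
      then show False using that(1)[OF e] by (simp add: frequently_def)
    qed
    have val: "?F l 0 = v 0"
    proof (rule antisym)
      show "?F l 0 \<le> v 0" by (rule le[OF cluster F_tendsto F_le])
      show "v 0 \<le> ?F l 0"
        by (rule le[OF cluster_F v_tendsto]) (use u_gt_ev in \<open>auto elim: eventually_mono\<close>)
    qed
    have "(\<phi> l * \<xi> l) *\<^sub>R g x = g 0"
      by (rule touch[OF _ Phi_deriv[OF xW] val F_le g(1)[OF W(2)] refl])
        (use u_gt_ev in \<open>auto elim: eventually_mono\<close>)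
    then show ?thesis using l1 val by (intro exI[of _ l]) (simp add: Phi_def)
  qed
  then obtain \<Lambda> where \<Lambda>: "\<And>x. x \<in> ball 0 \<rho> \<Longrightarrow> \<bar>\<Lambda> x - 1\<bar> < \<delta>0"
    "\<And>x. x \<in> ball 0 \<rho> \<Longrightarrow> \<phi> (\<Lambda> x) * v x + \<psi> (\<Lambda> x) = v 0"
    "\<And>x. x \<in> ball 0 \<rho> \<Longrightarrow> (\<phi> (\<Lambda> x) * \<xi> (\<Lambda> x)) *\<^sub>R g x = g 0"
    by metis
  have H1: "H 1 = v 0" by (simp add: H_def at1)
  \<comment> \<open>Where \<open>v x \<ge> v 0\<close>, the equation \<open>\<phi> (\<Lambda> x) * v x + \<psi> (\<Lambda> x) = v 0\<close> forces \<open>\<Lambda> x \<le> 1\<close>, and symmetrically where \<open>v x \<le> v 0\<close>.\<close>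
  have plane: "v 0 + g 0 \<bullet> y \<le> v y" if "y \<in> ball 0 \<rho>" for y
  proof (rule ge_tangent_plane_if_gradients_collinear[where c = "\<lambda>x. \<phi> (\<Lambda> x) * \<xi> (\<Lambda> x)", OF _ _ \<Lambda>(3) _ _ that])
    fix x :: 'a assume x: "x \<in> ball 0 \<rho>"
    note l = \<Lambda>(1)[OF x]
    have "x \<in> ball 0 R" using x \<rho>(2) by simp
    then show "(v has_derivative (\<lambda>h. g x \<bullet> h)) (at x)" using g(1) R(2) by blast
    show "0 < \<phi> (\<Lambda> x) * \<xi> (\<Lambda> x)" using \<delta>0(7,8)[OF l] by simp
    have \<phi>_pos: "\<phi> (\<Lambda> x) > 0" using \<delta>0(7)[OF l] .
    show "\<phi> (\<Lambda> x) * \<xi> (\<Lambda> x) \<le> 1" if "v 0 \<le> v x"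
    proof -
      have "H (\<Lambda> x) \<le> H 1"
        using \<Lambda>(2)[OF x] mult_left_mono[OF that less_imp_le[OF \<phi>_pos]] unfolding H1 unfolding H_def by linarith
      then have "\<Lambda> x \<le> 1" using H_mono[of 1 "\<Lambda> x"] l one by force
      then show ?thesis using \<phi>\<xi>_mono[of "\<Lambda> x" 1] l one at1 by simp
    qed
    show "1 \<le> \<phi> (\<Lambda> x) * \<xi> (\<Lambda> x)" if "v x \<le> v 0"
    proof -
      have "H 1 \<le> H (\<Lambda> x)"
        using \<Lambda>(2)[OF x] mult_left_mono[OF that less_imp_le[OF \<phi>_pos]] unfolding H1 unfolding H_def by linarith
      then have "1 \<le> \<Lambda> x" using H_mono[of "\<Lambda> x" 1] l one by force
      then show ?thesis using \<phi>\<xi>_mono[of 1 "\<Lambda> x"] l one at1 by simp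
    qed
  qed
  have "\<forall>\<^sub>F y in at 0. y \<in> ball (0::'a) \<rho>"
    using \<rho>(1) by (intro eventually_at_in_open') auto
  then have "\<forall>\<^sub>F y in at 0. v 0 + g 0 \<bullet> y < u y"
    using u_gt_ev by eventually_elim (use plane in force)
  then show False
    by (rule distr_superharmonic_not_above_affine_touching[OF dim U(1) U_ev U(2-4) cluster, rotated])
qed

end
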